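(* Let $d\ge1$, let $F_k$, $k=1,2$, be $d$-dimensional max-stable distribution functions with unit-$\alpha$-Fréchet margins, and let $1\le p<\alpha$. Define $$\mathfrak W_{\alpha,\infty}(F_1,F_2):=\inf_{Z^{(1)},Z^{(2)}}W_{\alpha,\|\cdot\|_\infty}\bigl(\mathrm{Law}(Z^{(1)}),\mathrm{Law}(Z^{(2)})\bigr),$$ where the infimum is over all normalised de Haan representers $Z^{(1)}$ of $F_1$ and $Z^{(2)}$ of $F_2$. Then $$W_{p,\|\cdot\|_\infty}(F_1,F_2)\le\Gamma\Bigl(1-\frac p\alpha\Bigr)^{1/p}\,\mathfrak W_{\alpha,\infty}(F_1,F_2).$$ Moreover, $$W_{p,\|\cdot\|_1}(F_1,F_2)\le\Gamma\Bigl(1-\frac p\alpha\Bigr)^{1/p}\,\mathfrak C_{\alpha,1}(F_1,F_2),$$ where $$\mathfrak C_{\alpha,1}(F_1,F_2):=\inf_{Z^{(1)},Z^{(2)}}\ \inf_{\pi\in\Pi(\mathrm{Law}(Z^{(1)}),\mathrm{Law}(Z^{(2)}))}\ \sum_{j=1}^d\left(\int|z_j-z_j'|^\alpha\,\pi(dz,dz')\right)^{1/\alpha},$$ with the outer infimum again over all normalised de Haan representers of $F_1$ and $F_2$.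
   Context: $\Gamma(\cdot)$ is the Gamma function. $\|x\|_\infty=\max_j|x_j|$, $\|x\|_1=\sum_j|x_j|$. De Haan representers: a $d$-dimensional max-stable distribution function $F$ with unit-$\alpha$-Fréchet margins (each margin is $x\mapsto\exp\{-x^{-\alpha}\}$ for $x>0$) has the form $F(x)=\exp\{-V(x)\}$ for $x\in(0,\infty)^d$ (and $F(x)=0$ if some coordinate is non-positive), where $$V(x)=\mathbb{E}\Bigl\{\max_{1\le j\le d}\frac{Z_j^\alpha}{x_j^\alpha}\Bigr\},\qquad x\in(0,\infty)^d,$$ for some random vector $Z=(Z_1,\dots,Z_d)$ with values in $[0,\infty)^d$ such that $\mathbb{E}\{Z_j^\alpha\}=1$ for all $j$ and $\mathbb{P}\{\max_jZ_j>0\}=1$. Any such $Z$ is called a normalised de Haan representer of $F$; it is not unique. Wasserstein distance: for $q\ge1$, a norm $\|\cdot\|$ on $\mathbb{R}^d$ and probability measures $\mu,\nu$ with finite $q$-th moment, $$W_{q,\|\cdot\|}(\mu,\nu)=\inf_{\pi\in\Pi(\mu,\nu)}\left(\int\|x-y\|^q\,\pi(dx,dy)\right)^{1/q},$$ where $\Pi(\mu,\nu)$ is the set of couplings of $\mu$ and $\nu$. $W_{p,\|\cdot\|}(F_1,F_2)$ denotes the distance between the probability laws with distribution functions $F_1,F_2$. *)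

theory Defs
  imports "HOL-Probability.Probability"
begin

section \<open>Distribution functions and their laws\<close>

text \<open>The order on \<open>real ^ 'n\<close> is the componentwise one, so \<open>{..x}\<close> is the lower orthant.\<close>

definition is_law_of :: "(real ^ 'n::finite) measure \<Rightarrow> (real ^ 'n \<Rightarrow> real) \<Rightarrow> bool" where
  "is_law_of \<mu> F \<longleftrightarrow>
     prob_space \<mu> \<and> sets \<mu> = sets borel \<and> (\<forall>x. F x = measure \<mu> {..x})"

definition distribution_fun :: "(real ^ 'n::finite \<Rightarrow> real) \<Rightarrow> bool" where
  "distribution_fun F \<longleftrightarrow> (\<exists>\<mu>. is_law_of \<mu> F)"

definition law_of :: "(real ^ 'n::finite \<Rightarrow> real) \<Rightarrow> (real ^ 'n) measure" where
  "law_of F = (THE \<mu>. is_law_of \<mu> F)"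

lemma is_law_of_unique:
  fixes F :: "real ^ 'n::finite \<Rightarrow> real"
  assumes \<mu>: "is_law_of \<mu> F" and \<nu>: "is_law_of \<nu> F"
  shows "\<mu> = \<nu>"
proof -
  interpret \<mu>: prob_space \<mu> using \<mu> by (simp add: is_law_of_def)
  interpret \<nu>: prob_space \<nu> using \<nu> by (simp add: is_law_of_def)
  have borel: "sets (borel :: (real ^ 'n) measure) = sigma_sets UNIV (range atMost)"
    by (subst borel_eq_atMost) simp
  have cover: "(\<Union>k. {..(\<chi> i. real k) :: real ^ 'n}) = UNIV"
  proof (intro equalityI subsetI UNIV_I)
    fix x :: "real ^ 'n"
    obtain k where k: "Max (range (($) x)) \<le> real k"
      using real_arch_simple by blast
    have "x $ i \<le> real k" for i
      by (rule order_trans[OF Max_ge k]) auto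
    then show "x \<in> (\<Union>k. {..(\<chi> i. real k) :: real ^ 'n})"
      by (auto simp: less_eq_vec_def)
  qed
  show ?thesis
  proof (rule measure_eqI_generator_eq[where E = "range atMost" and \<Omega> = UNIV
        and A = "\<lambda>k. {..(\<chi> i. real k)}"])
    have "{..a} \<inter> {..b} = {..inf a b}" for a b :: "real ^ 'n"
      by auto
    then show "Int_stable (range (atMost :: real ^ 'n \<Rightarrow> _))"
      by (auto simp: Int_stable_def)
    show "emeasure \<mu> X = emeasure \<nu> X" if X: "X \<in> range atMost" for X
      using X \<mu> \<nu> by (auto simp: \<mu>.emeasure_eq_measure \<nu>.emeasure_eq_measure is_law_of_def)
  qed (use \<mu> \<nu> borel cover in \<open>auto simp: is_law_of_def\<close>)
qed

lemma law_of_eq: "is_law_of \<mu> F \<Longrightarrow> law_of F = \<mu>"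
  unfolding law_of_def by (rule the_equality) (auto intro: is_law_of_unique)

section \<open>Max-stability, margins and de Haan representers\<close>

definition max_stable :: "(real ^ 'n::finite \<Rightarrow> real) \<Rightarrow> bool" where
  "max_stable F \<longleftrightarrow> distribution_fun F \<and>
     (\<forall>n\<ge>1. \<exists>a b :: real ^ 'n. (\<forall>j. 0 < a $ j) \<and>
        (\<forall>x. F (\<chi> j. a $ j * x $ j + b $ j) ^ n = F x))"

text \<open>By monotonicity each margin then vanishes on the non-positive half-line.\<close>

definition unit_frechet_margins :: "real \<Rightarrow> (real ^ 'n::finite \<Rightarrow> real) \<Rightarrow> bool" where
  "unit_frechet_margins \<alpha> F \<longleftrightarrow>
     (\<forall>j. \<forall>x>0. cdf (distr (law_of F) borel (\<lambda>y. y $ j)) x = exp (- (x powr - \<alpha>)))"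

definition de_haan_representer ::
  "real \<Rightarrow> (real ^ 'n::finite \<Rightarrow> real) \<Rightarrow> 'a measure \<Rightarrow> ('a \<Rightarrow> real ^ 'n) \<Rightarrow> bool" where
  "de_haan_representer \<alpha> F M Z \<longleftrightarrow>
     prob_space M \<and> Z \<in> M \<rightarrow>\<^sub>M borel \<and>
     (\<forall>\<omega>\<in>space M. \<forall>j. 0 \<le> Z \<omega> $ j) \<and>
     (\<forall>j. (\<integral>\<omega>. (Z \<omega> $ j) powr \<alpha> \<partial>M) = 1) \<and>
     measure M {\<omega> \<in> space M. (MAX j. Z \<omega> $ j) > 0} = 1 \<and>
     (\<forall>x. (\<forall>j. 0 < x $ j) \<longrightarrow>
        F x = exp (- (\<integral>\<omega>. (MAX j. (Z \<omega> $ j) powr \<alpha> / (x $ j) powr \<alpha>) \<partial>M)))"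

text \<open>Laws of normalised de Haan representers. Only probability spaces whose carrier type is
  \<open>real ^ 'n\<close> are used here; by the lemma \<open>distr_in_representer_laws\<close> below, this gives the laws
  of the representers on arbitrary probability spaces.\<close>

definition representer_laws ::
  "real \<Rightarrow> (real ^ 'n::finite \<Rightarrow> real) \<Rightarrow> (real ^ 'n) measure set" where
  "representer_laws \<alpha> F =
     {distr M borel Z | (M :: (real ^ 'n) measure) Z. de_haan_representer \<alpha> F M Z}"

lemma distr_in_representer_laws:
  fixes M :: "'a measure" and Z :: "'a \<Rightarrow> real ^ 'n::finite"
  assumes rep: "de_haan_representer \<alpha> F M Z"
  shows "distr M borel Z \<in> representer_laws \<alpha> F"
proof -
  have [measurable]: "Z \<in> M \<rightarrow>\<^sub>M borel" and M: "prob_space M"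
    and nonneg: "\<And>\<omega> j. \<omega> \<in> space M \<Longrightarrow> 0 \<le> Z \<omega> $ j"
    using rep by (auto simp: de_haan_representer_def)
  define Y :: "real ^ 'n \<Rightarrow> real ^ 'n" where "Y z = (\<chi> j. max 0 (z $ j))" for z
  have nth [measurable]: "(\<lambda>z :: real ^ 'n. z $ j) \<in> borel_measurable borel" for j
    by (intro borel_measurable_continuous_onI continuous_intros)
  have [measurable]: "Y \<in> borel \<rightarrow>\<^sub>M borel"
    unfolding Y_def
    by (intro borel_measurable_continuous_onI continuous_on_vec_lambda continuous_intros)
  have Max [measurable]: "(\<lambda>z. MAX j. f j z) \<in> borel_measurable borel"
    if "\<And>j. f j \<in> borel_measurable borel" for f :: "'n \<Rightarrow> real ^ 'n \<Rightarrow> real"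
    using that by (intro borel_measurable_Max) auto
  have [measurable]: "(\<lambda>z. Y z $ j) \<in> borel_measurable borel" for j
    using measurable_compose[OF \<open>Y \<in> _\<close> nth] .
  have YZ: "Y (Z \<omega>) = Z \<omega>" if "\<omega> \<in> space M" for \<omega>
    using nonneg[OF that] by (simp add: Y_def vec_eq_iff)
  let ?N = "distr M borel Z"
  have int: "(\<integral>z. g (Y z) \<partial>?N) = (\<integral>\<omega>. g (Z \<omega>) \<partial>M)"
    if [measurable]: "(\<lambda>z. g (Y z)) \<in> borel_measurable borel" for g :: "real ^ 'n \<Rightarrow> real"
    by (subst integral_distr) (auto intro!: Bochner_Integration.integral_cong simp: YZ)
  have meas: "measure ?N {z \<in> space ?N. (MAX j. Y z $ j) > 0}
      = measure M {\<omega> \<in> space M. (MAX j. Z \<omega> $ j) > 0}"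
    by (subst measure_distr) (auto intro!: arg_cong[where f = "measure M"] simp: YZ)
  have i1: "(\<integral>z. (Y z $ j) powr \<alpha> \<partial>?N) = (\<integral>\<omega>. (Z \<omega> $ j) powr \<alpha> \<partial>M)" for j
    by (rule int[of "\<lambda>z. (z $ j) powr \<alpha>"]) measurable
  have i2: "(\<integral>z. (MAX j. (Y z $ j) powr \<alpha> / (x $ j) powr \<alpha>) \<partial>?N)
      = (\<integral>\<omega>. (MAX j. (Z \<omega> $ j) powr \<alpha> / (x $ j) powr \<alpha>) \<partial>M)" for x
    by (rule int[of "\<lambda>z. MAX j. (z $ j) powr \<alpha> / (x $ j) powr \<alpha>"], rule Max) measurable
  have "de_haan_representer \<alpha> F ?N Y"
    unfolding de_haan_representer_def meas i1 i2
  proof (intro conjI)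
    show "prob_space ?N"
      by (intro prob_space.prob_space_distr M) measurable
    show "Y \<in> ?N \<rightarrow>\<^sub>M borel"
      by measurable
    show "\<forall>\<omega>\<in>space ?N. \<forall>j. 0 \<le> Y \<omega> $ j"
      by (simp add: Y_def)
  qed (use rep[unfolded de_haan_representer_def] in \<open>blast+\<close>)
  moreover have "distr ?N borel Y = ?N"
  proof -
    have "distr ?N borel Y = distr M borel (Y \<circ> Z)"
      by (rule distr_distr) measurable
    also have "\<dots> = ?N"
      by (rule distr_cong) (simp_all add: YZ)
    finally show ?thesis .
  qed
  ultimately show ?thesis
    unfolding representer_laws_def by (intro CollectI exI[of _ ?N] exI[of _ Y] conjI) (rule sym)
qed

section \<open>Wasserstein distances\<close>

definition couplings :: "'a measure \<Rightarrow> 'b measure \<Rightarrow> ('a \<times> 'b) measure set" where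
  "couplings \<mu> \<nu> =
     {\<pi>. sets \<pi> = sets (\<mu> \<Otimes>\<^sub>M \<nu>) \<and> distr \<pi> \<mu> fst = \<mu> \<and> distr \<pi> \<nu> snd = \<nu>}"

text \<open>The power \<open>x ^ r\<close> for \<open>r > 0\<close> on \<open>[0, \<infinity>]\<close>. All distances below take values in
  \<open>[0, \<infinity>]\<close>, so that divergent integrals count as \<open>\<infinity>\<close> and \<open>INF\<close> is a true infimum.\<close>

definition ennreal_powr :: "ennreal \<Rightarrow> real \<Rightarrow> ennreal" where
  "ennreal_powr x r = (if x = \<top> then \<top> else ennreal (enn2real x powr r))"

definition wasserstein ::
  "real \<Rightarrow> (real ^ 'n::finite \<Rightarrow> real) \<Rightarrow> (real ^ 'n) measure \<Rightarrow> (real ^ 'n) measure \<Rightarrow> ennreal" where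
  "wasserstein q N \<mu> \<nu> =
     (INF \<pi>\<in>couplings \<mu> \<nu>.
        ennreal_powr (\<integral>\<^sup>+(x, y). ennreal (N (x - y) powr q) \<partial>\<pi>) (1 / q))"

definition l1norm :: "real ^ 'n::finite \<Rightarrow> real" where
  "l1norm x = (\<Sum>j\<in>UNIV. \<bar>x $ j\<bar>)"

definition rep_wasserstein ::
  "real \<Rightarrow> (real ^ 'n::finite \<Rightarrow> real) \<Rightarrow> (real ^ 'n \<Rightarrow> real) \<Rightarrow> ennreal" where
  "rep_wasserstein \<alpha> F\<^sub>1 F\<^sub>2 =
     (INF \<mu>\<in>representer_laws \<alpha> F\<^sub>1. INF \<nu>\<in>representer_laws \<alpha> F\<^sub>2. wasserstein \<alpha> infnorm \<mu> \<nu>)"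

definition rep_cost ::
  "real \<Rightarrow> (real ^ 'n::finite \<Rightarrow> real) \<Rightarrow> (real ^ 'n \<Rightarrow> real) \<Rightarrow> ennreal" where
  "rep_cost \<alpha> F\<^sub>1 F\<^sub>2 =
     (INF \<mu>\<in>representer_laws \<alpha> F\<^sub>1. INF \<nu>\<in>representer_laws \<alpha> F\<^sub>2. INF \<pi>\<in>couplings \<mu> \<nu>.
        \<Sum>j\<in>UNIV. ennreal_powr (\<integral>\<^sup>+(z, z'). ennreal (\<bar>z $ j - z' $ j\<bar> powr \<alpha>) \<partial>\<pi>) (1 / \<alpha>))"

end

theory Submission
  imports Defs
begin

text \<open>
  Every coupling of two representers is turned into a coupling of the two max-stable laws by de
  Haan's spectral construction, driven by one and the same Poisson process. Let \<open>\<pi>\<close> be a coupling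
  of \<open>Law Z\<close> and \<open>Law Z'\<close>, and let \<open>(s, (z, z'))\<close> run through the points of a Poisson process on
  \<open>(0, \<infinity>) \<times> (real ^ 'n)\<^sup>2\<close> with intensity \<open>ds \<otimes> \<pi>\<close>. Put \<open>X\<^sub>j = sup s powr (-1/\<alpha>) * z\<^sub>j\<close> and \<open>Y\<^sub>j =
  sup s powr (-1/\<alpha>) * z'\<^sub>j\<close>, the suprema being over all points.

  For a nonnegative function \<open>h\<close> of the marks and \<open>c > 0\<close>, the event \<open>sup s powr (-1/\<alpha>) * h \<le> c\<close>
  says that no point lies in \<open>{(s, w). s < (h w / c) powr \<alpha>}\<close>, so that by the void probabilities
  of a Poisson process (\<open>measure_scatter_void\<close>) its probability is \<open>exp (- m / c powr \<alpha>)\<close> with \<open>m\<close>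
  the integral of \<open>h powr \<alpha>\<close> (\<open>measure_point_sup_frechet_le\<close>). Taking \<open>h w = max\<^sub>j z\<^sub>j / x\<^sub>j\<close> and
  \<open>c = 1\<close> identifies the laws of \<open>X\<close> and \<open>Y\<close> (\<open>distr_spectral_vec\<close>).

  Suprema are subadditive, so \<open>\<bar>X\<^sub>j - Y\<^sub>j\<bar>\<close> is at most the supremum \<open>T\<close> of \<open>s powr (-1/\<alpha>) * h\<close> as
  soon as \<open>h \<ge> \<bar>z\<^sub>j - z'\<^sub>j\<bar>\<close>; and \<open>T\<close> is a Frechet variable, whose \<open>p\<close>-th moment is \<open>Gamma (1 - p
  / \<alpha>) * m powr (p / \<alpha>)\<close> since \<open>m / T powr \<alpha>\<close> is a standard exponential variable if \<open>m > 0\<close>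
  (\<open>nn_integral_frechet_powr\<close>). The choice \<open>h = infnorm (z - z')\<close> gives the first bound. The
  choices \<open>h = \<bar>z\<^sub>j - z'\<^sub>j\<bar>\<close>, one for each \<open>j\<close>, together with the Minkowski inequality give the
  second one.
\<close>

section \<open>Poisson processes\<close>

text \<open>A Poisson number of independent points with law \<open>Q\<close>, that is, a Poisson process with
  intensity the probability measure \<open>Q\<close>. An outcome \<open>(n, f)\<close> stands for the points \<open>f 0, \<dots>, f (n -
  1)\<close>; the remaining values of \<open>f\<close> are ignored.\<close>

definition cell :: "'s measure \<Rightarrow> (nat \<times> (nat \<Rightarrow> 's)) measure" where
  "cell Q = measure_pmf (poisson_pmf 1) \<Otimes>\<^sub>M (\<Pi>\<^sub>M i\<in>UNIV. Q)"

lemma prob_space_cell: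
  assumes "prob_space Q"
  shows "prob_space (cell Q)"
proof -
  interpret Q: prob_space Q by fact
  interpret sequence_space Q ..
  interpret N: pair_prob_space "measure_pmf (poisson_pmf 1)" S ..
  show ?thesis
    unfolding cell_def by (rule N.prob_space_axioms)
qed

lemma cell_void_sets [measurable]:
  assumes [measurable]: "A \<in> sets Q"
  shows "{c \<in> space (cell Q). \<forall>i<fst c. snd c i \<notin> A} \<in> sets (cell Q)"
  unfolding cell_def by measurable

text \<open>Given that there are \<open>n\<close> points, they all avoid \<open>A\<close> with probability \<open>(1 - Q A) ^ n\<close>; the
  Poisson weights sum these powers to an exponential.\<close>

lemma measure_cell_void:
  assumes Q: "prob_space Q" and A [measurable]: "A \<in> sets Q"
  shows "measure (cell Q) {c \<in> space (cell Q). \<forall>i<fst c. snd c i \<notin> A} = exp (- measure Q A)"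
    (is "measure _ ?V = _")
proof -
  interpret Q: prob_space Q by fact
  interpret sequence_space Q ..
  let ?q = "1 - measure Q A"
  have Vsets: "?V \<in> sets (measure_pmf (poisson_pmf 1) \<Otimes>\<^sub>M S)"
    using cell_void_sets[OF A] by (simp add: cell_def)
  have slice: "emeasure S (Pair n -` ?V) = ennreal (?q ^ n)" for n
  proof -
    have "Pair n -` ?V = prod_emb UNIV (\<lambda>_. Q) {..<n} (\<Pi>\<^sub>E i\<in>{..<n}. space Q - A)"
      by (auto simp: cell_def space_pair_measure space_PiM prod_emb_def PiE_iff)
    also have "emeasure S \<dots> = (\<Prod>i<n. emeasure Q (space Q - A))"
      by (rule emeasure_PiM_emb) auto
    finally show ?thesis
      by (simp add: Q.emeasure_eq_measure Q.prob_compl ennreal_power)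
  qed
  have "emeasure (cell Q) ?V = (\<integral>\<^sup>+n. emeasure S (Pair n -` ?V) \<partial>measure_pmf (poisson_pmf 1))"
    using Vsets by (subst (1) cell_def) (rule P.emeasure_pair_measure_alt)
  also have "\<dots> = (\<Sum>n. ennreal (?q ^ n / fact n * exp (- 1)))"
    unfolding slice
    by (simp add: nn_integral_measure_pmf nn_integral_count_space_nat mult_ac
          flip: ennreal_mult)
  also have "\<dots> = ennreal (exp ?q * exp (- 1))"
  proof (rule suminf_ennreal_eq)
    show "(\<lambda>n. ?q ^ n / fact n * exp (- 1)) sums (exp ?q * exp (- 1))"
      using exp_converges[of ?q]
      by (intro sums_mult2) (simp add: divide_inverse mult.commute)
  qed simp
  also have "exp ?q * exp (- 1) = exp (- measure Q A)"
    by (simp flip: exp_add)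
  finally show ?thesis
    by (simp add: measure_def)
qed

text \<open>Independent cells \<open>Q 0, Q 1, \<dots>\<close>; their union \<open>points\<close> is a Poisson process whose intensity
  is the sum of the \<open>Q k\<close>.\<close>

definition scatter :: "(nat \<Rightarrow> 's measure) \<Rightarrow> (nat \<Rightarrow> nat \<times> (nat \<Rightarrow> 's)) measure" where
  "scatter Q = (\<Pi>\<^sub>M k\<in>UNIV. cell (Q k))"

definition points :: "(nat \<Rightarrow> nat \<times> (nat \<Rightarrow> 's)) \<Rightarrow> 's set" where
  "points \<omega> = (\<Union>k. {snd (\<omega> k) i | i. i < fst (\<omega> k)})"

lemma product_prob_space_cells:
  assumes "\<And>k. prob_space (Q k)"
  shows "product_prob_space (\<lambda>k. cell (Q k))"
  by (intro product_prob_spaceI prob_space_cell assms)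

lemma prob_space_scatter:
  assumes "\<And>k. prob_space (Q k)"
  shows "prob_space (scatter Q)"
  unfolding scatter_def by (intro prob_space_PiM prob_space_cell assms)

lemma scatter_void_eq:
  "{\<omega> \<in> space (scatter Q). points \<omega> \<inter> A = {}}
    = {\<omega> \<in> space (scatter Q).
        \<forall>k. \<omega> k \<in> {c \<in> space (cell (Q k)). \<forall>i<fst c. snd c i \<notin> A}}"
  by (fastforce simp: points_def scatter_def space_PiM PiE_iff)

lemma scatter_void_sets [measurable]:
  assumes "\<And>k. A \<in> sets (Q k)"
  shows "{\<omega> \<in> space (scatter Q). points \<omega> \<inter> A = {}} \<in> sets (scatter Q)"
proof -
  note [measurable] = cell_void_sets[OF assms]
  show ?thesis
    unfolding scatter_void_eq unfolding scatter_def by measurable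
qed

text \<open>The void probability of a Poisson process. Only sets \<open>A\<close> of finite intensity are needed.\<close>

lemma measure_scatter_void:
  assumes Q: "\<And>k. prob_space (Q k)" and A [measurable]: "\<And>k. A \<in> sets (Q k)"
    and m: "(\<lambda>k. measure (Q k) A) sums m"
  shows "measure (scatter Q) {\<omega> \<in> space (scatter Q). points \<omega> \<inter> A = {}} = exp (- m)"
proof -
  interpret C: product_prob_space "\<lambda>k. cell (Q k)" UNIV
    by (rule product_prob_space_cells) (rule Q)
  interpret prob_space "scatter Q"
    by (rule prob_space_scatter) (rule Q)
  let ?V = "\<lambda>k. {c \<in> space (cell (Q k)). \<forall>i<fst c. snd c i \<notin> A}"
  let ?W = "\<lambda>n. prod_emb UNIV (\<lambda>k. cell (Q k)) {..<n} (\<Pi>\<^sub>E k\<in>{..<n}. ?V k)"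
  have V: "?V k \<in> sets (cell (Q k))" for k
    by (rule cell_void_sets) (rule A)
  have meas: "measure (scatter Q) (?W n) = exp (- (\<Sum>k<n. measure (Q k) A))" for n
    unfolding scatter_def using V
    by (subst C.measure_PiM_emb) (auto simp: measure_cell_void[OF Q A] exp_sum simp flip: sum_negf)
  have "(\<lambda>n. measure (scatter Q) (?W n)) \<longlonglongrightarrow> measure (scatter Q) (\<Inter>n. ?W n)"
  proof (rule finite_Lim_measure_decseq)
    show "range ?W \<subseteq> sets (scatter Q)"
      unfolding scatter_def using V by auto
    show "decseq ?W"
      by (rule antimonoI) (auto simp: prod_emb_def PiE_iff Ball_def)
  qed
  moreover have "(\<Inter>n. ?W n) = {\<omega> \<in> space (scatter Q). points \<omega> \<inter> A = {}}"
    unfolding scatter_void_eq by (fastforce simp: scatter_def space_PiM prod_emb_def PiE_iff)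
  moreover have "(\<lambda>n. exp (- (\<Sum>k<n. measure (Q k) A))) \<longlonglongrightarrow> exp (- m)"
    using m by (intro tendsto_intros) (simp add: sums_def)
  ultimately show ?thesis
    unfolding meas by (auto intro: LIMSEQ_unique)
qed

lemma points_subset_space:
  assumes "\<omega> \<in> space (scatter Q)" and "\<And>k. space (Q k) = S"
  shows "points \<omega> \<subseteq> S"
proof -
  have "snd (\<omega> k) i \<in> space (Q k)" for k i
  proof -
    have "\<omega> k \<in> space (cell (Q k))"
      using assms(1) by (auto simp: scatter_def space_PiM)
    then show ?thesis
      by (auto simp: cell_def space_pair_measure space_PiM)
  qed
  then show ?thesis
    using assms(2) by (auto simp: points_def)
qed

section \<open>Suprema over a marked Poisson process\<close>

text \<open>The supremum of \<open>g\<close> over all points. It takes values in \<open>[0, \<infinity>]\<close>, so it is \<open>0\<close> when there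
  are no points.\<close>

definition point_sup :: "('s \<Rightarrow> ennreal) \<Rightarrow> (nat \<Rightarrow> nat \<times> (nat \<Rightarrow> 's)) \<Rightarrow> ennreal" where
  "point_sup g \<omega> = (SUP s\<in>points \<omega>. g s)"

text \<open>The law of a uniform height in \<open>(k, k + 1]\<close> with an independent mark of law \<open>P\<close>. The strips
  \<open>k = 0, 1, \<dots>\<close> add up to Lebesgue measure on \<open>(0, \<infinity>)\<close> times \<open>P\<close>, so \<open>scatter (strip P)\<close> is the
  Poisson process that drives the spectral construction.\<close>

definition strip :: "'w measure \<Rightarrow> nat \<Rightarrow> (real \<times> 'w) measure" where
  "strip P k = uniform_measure lborel {real k<..real k + 1} \<Otimes>\<^sub>M P"

lemma sets_strip [measurable_cong]: "sets (strip P k) = sets (borel \<Otimes>\<^sub>M P)"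
  unfolding strip_def by (intro sets_pair_measure_cong) auto

lemma space_strip: "space (strip P k) = UNIV \<times> space P"
  by (simp add: strip_def space_pair_measure)

lemma prob_space_strip:
  assumes "prob_space P"
  shows "prob_space (strip P k)"
proof -
  interpret P: prob_space P by fact
  interpret U: prob_space "uniform_measure lborel {real k<..real k + 1}"
    by (rule prob_space_uniform_measure) auto
  interpret N: pair_prob_space "uniform_measure lborel {real k<..real k + 1}" P ..
  show ?thesis
    unfolding strip_def by (rule N.prob_space_axioms)
qed

lemma suminf_emeasure_strip:
  assumes P: "prob_space P" and A [measurable]: "A \<in> sets (borel \<Otimes>\<^sub>M P)"
  shows "(\<Sum>k. emeasure (strip P k) A) = (\<integral>\<^sup>+w. emeasure lborel {s. 0 < s \<and> (s, w) \<in> A} \<partial>P)"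
proof -
  interpret P: prob_space P by fact
  have A': "A \<in> sets (lborel \<Otimes>\<^sub>M P)"
    using A by (simp cong: sets_pair_measure_cong)
  have sec [measurable]: "{s. (s, w) \<in> A} \<in> sets borel" for w
    using sets_Pair2[OF A, of w] by (simp add: vimage_def)
  have strip: "emeasure (strip P k) A
      = (\<integral>\<^sup>+w. emeasure lborel ({real k<..real k + 1} \<inter> {s. (s, w) \<in> A}) \<partial>P)" for k
  proof -
    interpret U: prob_space "uniform_measure lborel {real k<..real k + 1}"
      by (rule prob_space_uniform_measure) auto
    interpret N: pair_prob_space "uniform_measure lborel {real k<..real k + 1}" P ..
    show ?thesis
      using A unfolding strip_def
      by (subst N.emeasure_pair_measure_alt2)
        (auto simp: vimage_def emeasure_uniform_measure sec divide_ennreal_def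
          cong: sets_pair_measure_cong intro!: nn_integral_cong)
  qed
  have meas: "(\<lambda>w. emeasure lborel ({real k<..real k + 1} \<inter> {s. (s, w) \<in> A}))
      \<in> borel_measurable P" for k
  proof -
    have "({real k<..real k + 1} \<times> space P) \<inter> A \<in> sets (lborel \<Otimes>\<^sub>M P)"
      using A' by (intro sets.Int pair_measureI) auto
    then have "(\<lambda>w. emeasure lborel ((\<lambda>s. (s, w)) -` (({real k<..real k + 1} \<times> space P) \<inter> A)))
        \<in> borel_measurable P"
      by (intro pair_sigma_finite.measurable_emeasure_Pair2)
        (unfold_locales)
    then show ?thesis
      by (subst measurable_cong) (auto intro!: arg_cong[where f = "emeasure lborel"])
  qed
  have "(\<Sum>k. emeasure (strip P k) A)
      = (\<integral>\<^sup>+w. (\<Sum>k. emeasure lborel ({real k<..real k + 1} \<inter> {s. (s, w) \<in> A})) \<partial>P)"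
    unfolding strip by (rule nn_integral_suminf[symmetric]) (rule meas)
  also have "\<dots> = (\<integral>\<^sup>+w. emeasure lborel {s. 0 < s \<and> (s, w) \<in> A} \<partial>P)"
  proof (rule nn_integral_cong)
    fix w
    have "(\<Sum>k. emeasure lborel ({real k<..real k + 1} \<inter> {s. (s, w) \<in> A}))
        = emeasure lborel (\<Union>k. {real k<..real k + 1} \<inter> {s. (s, w) \<in> A})"
    proof (rule suminf_emeasure)
      have "k = l" if "real k < s" "s \<le> real k + 1" "real l < s" "s \<le> real l + 1" for k l s
        using that by linarith
      then show "disjoint_family (\<lambda>k. {real k<..real k + 1} \<inter> {s. (s, w) \<in> A})"
        by (fastforce simp: disjoint_family_on_def)
    qed auto
    also have "(\<Union>k. {real k<..real k + 1} \<inter> {s. (s, w) \<in> A}) = {s. 0 < s \<and> (s, w) \<in> A}"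
    proof -
      have "\<exists>k. real k < s \<and> s \<le> real k + 1" if "0 < s" for s
        using that by (intro exI[of _ "nat (\<lceil>s\<rceil> - 1)"]) linarith
      then show ?thesis
        by (auto intro: order_le_less_trans[OF of_nat_0_le_iff])
    qed
    finally show "(\<Sum>k. emeasure lborel ({real k<..real k + 1} \<inter> {s. (s, w) \<in> A}))
        = emeasure lborel {s. 0 < s \<and> (s, w) \<in> A}" .
  qed
  finally show ?thesis .
qed

lemma point_sup_le_iff:
  assumes "\<omega> \<in> space (scatter (strip P))"
  shows "point_sup g \<omega> \<le> c \<longleftrightarrow> points \<omega> \<inter> {x \<in> space (borel \<Otimes>\<^sub>M P). c < g x} = {}"
  using points_subset_space[OF assms space_strip]
  by (force simp: point_sup_def SUP_le_iff not_le[symmetric] space_pair_measure)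

lemma borel_measurable_point_sup [measurable]:
  assumes [measurable]: "g \<in> borel_measurable (borel \<Otimes>\<^sub>M P)"
  shows "point_sup g \<in> borel_measurable (scatter (strip P))"
proof (rule borel_measurableI_le)
  fix c
  have "{\<omega> \<in> space (scatter (strip P)). point_sup g \<omega> \<le> c}
      = {\<omega> \<in> space (scatter (strip P)). points \<omega> \<inter> {x \<in> space (borel \<Otimes>\<^sub>M P). c < g x} = {}}"
    using point_sup_le_iff by blast
  also have "\<dots> \<in> sets (scatter (strip P))"
    by (rule scatter_void_sets) (simp add: sets_strip)
  finally show "{\<omega> \<in> space (scatter (strip P)). point_sup g \<omega> \<le> c} \<in> sets (scatter (strip P))" .
qed

text \<open>The value \<open>s powr (-1/\<alpha>) * h w\<close> that the point \<open>(s, w)\<close> contributes. The map \<open>ennreal\<close>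
  replaces negative values of \<open>h\<close> by \<open>0\<close>, so only the positive part of \<open>h\<close> matters.\<close>

definition frechet_mark :: "real \<Rightarrow> ('w \<Rightarrow> real) \<Rightarrow> real \<times> 'w \<Rightarrow> ennreal" where
  "frechet_mark \<alpha> h = (\<lambda>(s, w). ennreal (s powr (- 1 / \<alpha>) * h w))"

lemma borel_measurable_frechet_mark [measurable]:
  assumes [measurable]: "h \<in> borel_measurable P"
  shows "frechet_mark \<alpha> h \<in> borel_measurable (borel \<Otimes>\<^sub>M P)"
  unfolding frechet_mark_def by measurable

text \<open>The supremum has a Frechet distribution, degenerate at \<open>0\<close> if \<open>m = 0\<close>.\<close>

lemma measure_point_sup_frechet_le:
  assumes P: "prob_space P" and h [measurable]: "h \<in> borel_measurable P"
    and \<alpha>: "0 < \<alpha>" and c: "0 < c" and m: "0 \<le> m"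
    and int: "(\<integral>\<^sup>+w. ennreal (max 0 (h w) powr \<alpha>) \<partial>P) = ennreal m"
  shows "measure (scatter (strip P))
           {\<omega> \<in> space (scatter (strip P)). point_sup (frechet_mark \<alpha> h) \<omega> \<le> ennreal c}
         = exp (- (m / c powr \<alpha>))"
proof -
  let ?A = "{x \<in> space (borel \<Otimes>\<^sub>M P). ennreal c < frechet_mark \<alpha> h x}"
  have A: "?A \<in> sets (borel \<Otimes>\<^sub>M P)"
    by measurable
  have ray: "{s. 0 < s \<and> (s, w) \<in> ?A} = {0<..<(max 0 (h w) / c) powr \<alpha>}"
    if w: "w \<in> space P" for w
  proof -
    have "c < s powr (- 1 / \<alpha>) * h w \<longleftrightarrow> s < (max 0 (h w) / c) powr \<alpha>" if s: "0 < s" for s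
    proof (cases "0 < h w")
      case True
      have "c < s powr (- 1 / \<alpha>) * h w \<longleftrightarrow> s powr (1 / \<alpha>) < h w / c"
        using s c by (simp add: powr_minus field_simps)
      also have "\<dots> \<longleftrightarrow> (s powr (1 / \<alpha>)) powr \<alpha> < (h w / c) powr \<alpha>"
        using \<alpha> c s True by (auto intro: powr_less_mono2 powr_less_cancel2[of \<alpha>])
      finally show ?thesis
        using s \<alpha> True by (simp add: powr_powr max_def)
    next
      case False
      then have "s powr (- 1 / \<alpha>) * h w \<le> 0"
        by (intro mult_nonneg_nonpos) auto
      then show ?thesis
        using s c False by (auto simp: max_def)
    qed
    then show ?thesis
      using w c by (auto simp: frechet_mark_def space_pair_measure ennreal_less_iff)
  qed
  have "(\<Sum>k. emeasure (strip P k) ?A) = (\<integral>\<^sup>+w. ennreal ((max 0 (h w) / c) powr \<alpha>) \<partial>P)"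
    unfolding suminf_emeasure_strip[OF P A] by (intro nn_integral_cong) (simp only: ray, simp)
  also have "\<dots> = (\<integral>\<^sup>+w. ennreal (1 / c powr \<alpha>) * ennreal (max 0 (h w) powr \<alpha>) \<partial>P)"
    using c by (intro nn_integral_cong) (simp add: powr_divide flip: ennreal_mult)
  also have "\<dots> = ennreal (m / c powr \<alpha>)"
    using m by (subst nn_integral_cmult) (auto simp: int simp flip: ennreal_mult)
  finally have total: "(\<Sum>k. emeasure (strip P k) ?A) = ennreal (m / c powr \<alpha>)" .
  have sums: "(\<lambda>k. measure (strip P k) ?A) sums (m / c powr \<alpha>)"
  proof -
    interpret S: prob_space "strip P k" for k
      by (rule prob_space_strip[OF P])
    have "(\<lambda>k. ennreal (measure (strip P k) ?A)) sums ennreal (m / c powr \<alpha>)"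
      unfolding total[symmetric] by (simp add: S.emeasure_eq_measure summable_sums)
    then show ?thesis
      using m by (subst (asm) sums_ennreal) auto
  qed
  have "{\<omega> \<in> space (scatter (strip P)). point_sup (frechet_mark \<alpha> h) \<omega> \<le> ennreal c}
      = {\<omega> \<in> space (scatter (strip P)). points \<omega> \<inter> ?A = {}}"
    using point_sup_le_iff by blast
  then show ?thesis
    using measure_scatter_void[OF prob_space_strip[OF P] _ sums] A by (simp add: sets_strip)
qed

section \<open>Moments of Frechet variables\<close>

lemma (in prob_space) AE_finite_frechet:
  fixes T :: "'a \<Rightarrow> ennreal"
  assumes [measurable]: "T \<in> borel_measurable M" and \<alpha>: "0 < \<alpha>"
    and cdf: "\<And>c. 0 < c \<Longrightarrow> \<P>(\<omega> in M. T \<omega> \<le> ennreal c) = exp (- (m / c powr \<alpha>))"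
  shows "AE \<omega> in M. T \<omega> < \<top>"
proof -
  have "((\<lambda>c. exp (- (m * c powr - \<alpha>))) \<longlongrightarrow> exp (- (m * 0))) at_top"
    using \<alpha> by (intro tendsto_intros tendsto_neg_powr filterlim_ident) auto
  then have "((\<lambda>c. exp (- (m / c powr \<alpha>))) \<longlongrightarrow> 1) at_top"
    by (simp add: powr_minus divide_inverse)
  moreover have "\<forall>\<^sub>F c in at_top. exp (- (m / c powr \<alpha>)) \<le> \<P>(\<omega> in M. T \<omega> < \<top>)"
    using eventually_gt_at_top[of 0]
  proof eventually_elim
    case (elim c)
    then show ?case
      unfolding cdf[OF elim, symmetric]
      by (intro finite_measure_mono) (auto intro: le_less_trans simp: ennreal_less_top)
  qed
  ultimately have "1 \<le> \<P>(\<omega> in M. T \<omega> < \<top>)"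
    by (rule tendsto_upperbound) simp
  then have "\<P>(\<omega> in M. T \<omega> < \<top>) = 1"
    using prob_le_1 by (intro antisym) auto
  then show ?thesis
    by (subst (asm) prob_Collect_eq_1) auto
qed

lemma (in prob_space) AE_pos_frechet:
  fixes T :: "'a \<Rightarrow> ennreal"
  assumes [measurable]: "T \<in> borel_measurable M" and \<alpha>: "0 < \<alpha>" and m: "0 < m"
    and cdf: "\<And>c. 0 < c \<Longrightarrow> \<P>(\<omega> in M. T \<omega> \<le> ennreal c) = exp (- (m / c powr \<alpha>))"
  shows "AE \<omega> in M. 0 < T \<omega>"
proof -
  have "((\<lambda>c. exp (- (m / c powr \<alpha>))) \<longlongrightarrow> 0) (at_right 0)"
    using \<alpha> m by real_asymp
  moreover have "\<forall>\<^sub>F c in at_right 0. \<P>(\<omega> in M. T \<omega> = 0) \<le> exp (- (m / c powr \<alpha>))"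
    using eventually_at_right_less[of 0]
  proof eventually_elim
    case (elim c)
    then show ?case
      unfolding cdf[OF elim, symmetric]
      by (intro finite_measure_mono) auto
  qed
  ultimately have "\<P>(\<omega> in M. T \<omega> = 0) \<le> 0"
    by (rule tendsto_lowerbound) simp
  then have "\<P>(\<omega> in M. T \<omega> = 0) = 0"
    by (intro antisym) auto
  then have "AE \<omega> in M. T \<omega> \<noteq> 0"
    by (subst (asm) prob_Collect_eq_0) auto
  then show ?thesis
    by eventually_elim (simp add: zero_less_iff_neq_zero)
qed

text \<open>The Frechet distribution has no atoms on the positive half-line.\<close>

lemma (in prob_space) prob_less_frechet:
  fixes T :: "'a \<Rightarrow> ennreal"
  assumes [measurable]: "T \<in> borel_measurable M" and t: "0 < t"
    and cdf: "\<And>c. 0 < c \<Longrightarrow> \<P>(\<omega> in M. T \<omega> \<le> ennreal c) = exp (- (m / c powr \<alpha>))"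
  shows "\<P>(\<omega> in M. T \<omega> < ennreal t) = exp (- (m / t powr \<alpha>))"
proof (rule antisym)
  show "\<P>(\<omega> in M. T \<omega> < ennreal t) \<le> exp (- (m / t powr \<alpha>))"
    unfolding cdf[OF t, symmetric] by (intro finite_measure_mono) auto
  have "((\<lambda>c. exp (- (m / c powr \<alpha>))) \<longlongrightarrow> exp (- (m / t powr \<alpha>))) (at_left t)"
    using t by (intro tendsto_intros) auto
  moreover have "\<forall>\<^sub>F c in at_left t. exp (- (m / c powr \<alpha>)) \<le> \<P>(\<omega> in M. T \<omega> < ennreal t)"
    using eventually_at_left_real[OF t]
  proof eventually_elim
    case (elim c)
    then have "0 < c" "c < t" by auto
    then show ?case
      unfolding cdf[OF \<open>0 < c\<close>, symmetric]
      using \<open>c < t\<close> t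
      by (intro finite_measure_mono) (auto elim!: le_less_trans simp: ennreal_less_iff)
  qed
  ultimately show "exp (- (m / t powr \<alpha>)) \<le> \<P>(\<omega> in M. T \<omega> < ennreal t)"
    by (rule tendsto_upperbound) simp
qed

lemma (in prob_space) nn_integral_exponential_powr:
  assumes V: "distributed M lborel V (exponential_density 1)" and r: "r < 1"
  shows "(\<integral>\<^sup>+\<omega>. ennreal (V \<omega> powr - r) \<partial>M) = ennreal (Gamma (1 - r))"
proof -
  have "(\<integral>\<^sup>+\<omega>. ennreal (V \<omega> powr - r) \<partial>M)
      = (\<integral>\<^sup>+x. ennreal (exponential_density 1 x) * ennreal (x powr - r) \<partial>lborel)"
    by (rule distributed_nn_integral[OF V, symmetric]) measurable
  also have "\<dots> = (\<integral>\<^sup>+x. ennreal (indicator {0..} x * x powr ((1 - r) - 1) / exp x) \<partial>lborel)"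
    by (intro nn_integral_cong)
      (auto simp: exponential_density_def exp_minus divide_inverse mult.commute
        simp flip: ennreal_mult split: split_indicator)
  also have "\<dots> = ennreal (Gamma (1 - r))"
    using r by (subst Gamma_conv_nn_integral_real) auto
  finally show ?thesis .
qed

lemma (in prob_space) nn_integral_frechet_powr:
  fixes T :: "'a \<Rightarrow> ennreal"
  assumes [measurable]: "T \<in> borel_measurable M"
    and p: "0 < p" "p < \<alpha>" and m: "0 \<le> m"
    and cdf: "\<And>c. 0 < c \<Longrightarrow> \<P>(\<omega> in M. T \<omega> \<le> ennreal c) = exp (- (m / c powr \<alpha>))"
  shows "(\<integral>\<^sup>+\<omega>. ennreal (enn2real (T \<omega>) powr p) \<partial>M) = ennreal (Gamma (1 - p / \<alpha>) * m powr (p / \<alpha>))"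
proof (cases "m = 0")
  case True
  have "AE \<omega> in M. \<forall>n. T \<omega> \<le> ennreal (1 / real (Suc n))"
  proof (subst AE_all_countable, rule allI)
    fix n
    have "\<P>(\<omega> in M. T \<omega> \<le> ennreal (1 / real (Suc n))) = 1"
      by (subst cdf) (auto simp: True)
    then show "AE \<omega> in M. T \<omega> \<le> ennreal (1 / real (Suc n))"
      by (subst (asm) prob_Collect_eq_1) auto
  qed
  then have "AE \<omega> in M. enn2real (T \<omega>) powr p = 0"
  proof eventually_elim
    case (elim \<omega>)
    have "enn2real (T \<omega>) \<le> 1 / real (Suc n)" for n
      using elim enn2real_leI by fastforce
    then have "enn2real (T \<omega>) \<le> 0"
      by (intro LIMSEQ_le_const[OF LIMSEQ_inverse_real_of_nat]) (auto simp: inverse_eq_divide)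
    then show ?case
      using enn2real_nonneg[of "T \<omega>"] by simp
  qed
  then have "(\<integral>\<^sup>+\<omega>. ennreal (enn2real (T \<omega>) powr p) \<partial>M) = (\<integral>\<^sup>+\<omega>. 0 \<partial>M)"
    by (intro nn_integral_cong_AE) auto
  then show ?thesis
    using p by (simp add: True)
next
  case False
  with m have m: "0 < m" by simp
  have \<alpha>: "0 < \<alpha>" using p by simp
  \<comment> \<open>Inverting the distribution function turns \<open>T\<close> into a standard exponential variable.\<close>
  define V where "V \<omega> = m / enn2real (T \<omega>) powr \<alpha>" for \<omega>
  have [measurable]: "V \<in> borel_measurable M"
    unfolding V_def by measurable
  have "AE \<omega> in M. T \<omega> < \<top>"
    by (rule AE_finite_frechet[OF _ \<alpha> cdf]) auto
  moreover have "AE \<omega> in M. 0 < T \<omega>"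
    by (rule AE_pos_frechet[OF _ \<alpha> m cdf]) auto
  ultimately have AE: "AE \<omega> in M. 0 < T \<omega> \<and> T \<omega> < \<top>"
    by eventually_elim simp
  have real: "\<exists>x>0. T \<omega> = ennreal x" if "0 < T \<omega>" "T \<omega> < \<top>" for \<omega>
    using that by (cases "T \<omega>") auto
  have "distributed M lborel V (exponential_density 1)"
  proof (subst exponential_distributed_iff, simp, intro conjI allI impI)
    show "V \<in> borel_measurable M" by simp
    fix a :: real assume "0 \<le> a"
    show "\<P>(\<omega> in M. V \<omega> \<le> a) = 1 - exp (- a * 1)"
    proof (cases "a = 0")
      case True
      have "AE \<omega> in M. \<not> V \<omega> \<le> a"
        using AE
      proof eventually_elim
        case (elim \<omega>)
        then obtain x where "0 < x" "T \<omega> = ennreal x"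
          using real by blast
        then show ?case
          using m by (simp add: V_def True not_le)
      qed
      then have "\<P>(\<omega> in M. V \<omega> \<le> a) = 0"
        by (subst prob_Collect_eq_0) auto
      then show ?thesis
        by (simp add: True)
    next
      case False
      with \<open>0 \<le> a\<close> have a: "0 < a" by simp
      define t where "t = (m / a) powr (1 / \<alpha>)"
      have t: "0 < t" "m / t powr \<alpha> = a"
        using a m \<alpha> by (auto simp: t_def powr_powr)
      have "\<P>(\<omega> in M. V \<omega> \<le> a) = \<P>(\<omega> in M. \<not> T \<omega> < ennreal t)"
      proof (rule finite_measure_eq_AE)
        show "AE \<omega> in M. (\<omega> \<in> {\<omega> \<in> space M. V \<omega> \<le> a}) = (\<omega> \<in> {\<omega> \<in> space M. \<not> T \<omega> < ennreal t})"
          using AE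
        proof eventually_elim
          case (elim \<omega>)
          obtain x where x: "0 < x" "T \<omega> = ennreal x"
            using real elim by blast
          have "V \<omega> \<le> a \<longleftrightarrow> m / x powr \<alpha> \<le> m / t powr \<alpha>"
            using x t by (simp add: V_def)
          also have "\<dots> \<longleftrightarrow> t powr \<alpha> \<le> x powr \<alpha>"
            using m x t(1) by (simp add: field_simps)
          also have "\<dots> \<longleftrightarrow> t \<le> x"
            using x(1) t(1) \<alpha> powr_mono2[of \<alpha> t x] powr_less_mono2[of \<alpha> x t]
            by (cases "t \<le> x") auto
          finally show ?case
            using x t by (simp add: ennreal_less_iff not_less)
        qed
      qed auto
      also have "\<dots> = 1 - \<P>(\<omega> in M. T \<omega> < ennreal t)"
        by (rule prob_neg) measurable
      finally show ?thesis
        by (simp add: prob_less_frechet[OF _ t(1) cdf] t)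
    qed
  qed
  from nn_integral_exponential_powr[OF this, of "p / \<alpha>"]
  have V: "(\<integral>\<^sup>+\<omega>. ennreal (V \<omega> powr - (p / \<alpha>)) \<partial>M) = ennreal (Gamma (1 - p / \<alpha>))"
    using p by simp
  have "(\<integral>\<^sup>+\<omega>. ennreal (enn2real (T \<omega>) powr p) \<partial>M)
      = (\<integral>\<^sup>+\<omega>. ennreal (m powr (p / \<alpha>)) * ennreal (V \<omega> powr - (p / \<alpha>)) \<partial>M)"
  proof (rule nn_integral_cong_AE)
    show "AE \<omega> in M. ennreal (enn2real (T \<omega>) powr p)
        = ennreal (m powr (p / \<alpha>)) * ennreal (V \<omega> powr - (p / \<alpha>))"
      using AE
    proof eventually_elim
      case (elim \<omega>)
      obtain x where x: "0 < x" "T \<omega> = ennreal x"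
        using real elim by blast
      have "m powr (p / \<alpha>) * V \<omega> powr - (p / \<alpha>) = x powr p"
        using x m \<alpha> by (simp add: V_def powr_divide powr_minus powr_powr)
      then show ?case
        using x by (simp flip: ennreal_mult)
    qed
  qed
  also have "\<dots> = ennreal (m powr (p / \<alpha>)) * ennreal (Gamma (1 - p / \<alpha>))"
    by (subst nn_integral_cmult) (auto simp: V)
  finally show ?thesis
    by (simp add: mult.commute ennreal_mult')
qed

section \<open>The Minkowski inequality\<close>

lemma convex_on_powr_nonneg:
  fixes p :: real
  assumes p: "1 \<le> p"
  shows "convex_on {0..} (\<lambda>x. x powr p)"
proof (rule convex_on_linorderI)
  fix t x y :: real
  assume t: "0 < t" "t < 1" and xy: "x \<in> {0..}" "y \<in> {0..}" "x < y"
  show "((1 - t) *\<^sub>R x + t *\<^sub>R y) powr p \<le> (1 - t) * x powr p + t * y powr p"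
  proof (cases "x = 0")
    case True
    have "t powr p \<le> t powr 1"
      using t p by (intro powr_mono') auto
    then show ?thesis
      using True t xy by (simp add: powr_mult mult_right_mono)
  next
    case False
    then show ?thesis
      using convex_onD[OF powr_convex[OF p], of t x y] t xy by simp
  qed
qed simp

text \<open>The Minkowski inequality for finitely many nonnegative functions, stated with positive upper
  bounds \<open>c i\<close> for the norms. With \<open>C = (\<Sum>i\<in>I. c i)\<close>, the sum of the \<open>f i\<close> is \<open>C\<close> times a convex
  combination, with weights \<open>c i / C\<close>, of the functions \<open>f i / c i\<close>, whose norm is at most \<open>1\<close>.\<close>

lemma minkowski_sum:
  fixes f :: "'i \<Rightarrow> 'a \<Rightarrow> real"
  assumes I: "finite I" and p: "1 \<le> p"
    and [measurable]: "\<And>i. i \<in> I \<Longrightarrow> f i \<in> borel_measurable M"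
    and f: "\<And>i x. i \<in> I \<Longrightarrow> 0 \<le> f i x" and c: "\<And>i. i \<in> I \<Longrightarrow> 0 < c i"
    and le: "\<And>i. i \<in> I \<Longrightarrow> (\<integral>\<^sup>+x. ennreal (f i x powr p) \<partial>M) \<le> ennreal (c i powr p)"
  shows "(\<integral>\<^sup>+x. ennreal ((\<Sum>i\<in>I. f i x) powr p) \<partial>M) \<le> ennreal ((\<Sum>i\<in>I. c i) powr p)"
proof (cases "I = {}")
  case False
  define C where "C = (\<Sum>i\<in>I. c i)"
  have C: "0 < C"
    unfolding C_def using I False c by (intro sum_pos)
  have convex: "(\<Sum>i\<in>I. f i x) powr p
      \<le> C powr p * (\<Sum>i\<in>I. c i / C * (f i x powr p / c i powr p))" for x
  proof -
    have "(\<Sum>i\<in>I. (c i / C) *\<^sub>R (f i x / c i)) powr p \<le> (\<Sum>i\<in>I. c i / C * (f i x / c i) powr p)"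
    proof (rule convex_on_sum[OF I False convex_on_powr_nonneg[OF p]])
      show "(\<Sum>i\<in>I. c i / C) = 1"
        using C by (simp add: C_def flip: sum_divide_distrib)
    qed (use C c f in \<open>auto simp: less_imp_le\<close>)
    also have "(\<Sum>i\<in>I. (c i / C) *\<^sub>R (f i x / c i)) = (\<Sum>i\<in>I. f i x) / C"
      unfolding sum_divide_distrib using c by (intro sum.cong) (auto dest!: c)
    finally show ?thesis
      using C c f by (simp add: powr_divide sum_nonneg field_simps less_imp_le)
  qed
  have "(\<integral>\<^sup>+x. ennreal ((\<Sum>i\<in>I. f i x) powr p) \<partial>M)
      \<le> (\<integral>\<^sup>+x. (\<Sum>i\<in>I. ennreal (C powr p * (c i / C) / c i powr p) * ennreal (f i x powr p)) \<partial>M)"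
  proof (rule nn_integral_mono)
    fix x
    have "(\<Sum>i\<in>I. ennreal (C powr p * (c i / C) / c i powr p) * ennreal (f i x powr p))
        = ennreal (C powr p * (\<Sum>i\<in>I. c i / C * (f i x powr p / c i powr p)))"
      using C c by (subst sum_distrib_left, subst sum_ennreal[symmetric])
        (auto simp: less_imp_le mult_ac simp flip: ennreal_mult intro!: sum.cong)
    then show "ennreal ((\<Sum>i\<in>I. f i x) powr p)
        \<le> (\<Sum>i\<in>I. ennreal (C powr p * (c i / C) / c i powr p) * ennreal (f i x powr p))"
      using convex by (simp add: ennreal_leI)
  qed
  also have "\<dots> = (\<Sum>i\<in>I. ennreal (C powr p * (c i / C) / c i powr p)
      * (\<integral>\<^sup>+x. ennreal (f i x powr p) \<partial>M))"
    by (subst nn_integral_sum) (auto intro!: sum.cong nn_integral_cmult)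
  also have "\<dots> \<le> (\<Sum>i\<in>I. ennreal (C powr p * (c i / C) / c i powr p) * ennreal (c i powr p))"
    by (intro sum_mono mult_left_mono le) auto
  also have "\<dots> = (\<Sum>i\<in>I. ennreal (C powr p * (c i / C)))"
    using C c by (intro sum.cong) (auto simp: less_imp_le simp flip: ennreal_mult dest!: c)
  also have "\<dots> = ennreal (\<Sum>i\<in>I. C powr p * (c i / C))"
    using C c by (intro sum_ennreal) (auto simp: less_imp_le)
  also have "(\<Sum>i\<in>I. C powr p * (c i / C)) = C powr p"
    using C by (simp add: C_def flip: sum_distrib_left sum_divide_distrib)
  finally show ?thesis
    by (simp add: C_def)
qed simp

section \<open>Laws with Frechet margins\<close>

lemma borel_measurable_vec_nth [measurable]:
  "(\<lambda>z :: real ^ 'n::finite. z $ j) \<in> borel_measurable borel"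
  by (intro borel_measurable_continuous_onI continuous_intros)

lemma borel_measurable_vec_lambda [measurable (raw)]:
  fixes f :: "'n::finite \<Rightarrow> 'a \<Rightarrow> real"
  assumes [measurable]: "\<And>j. f j \<in> borel_measurable M"
  shows "(\<lambda>x. \<chi> j. f j x) \<in> borel_measurable M"
proof -
  have "(\<lambda>x. \<Sum>j\<in>UNIV. f j x *\<^sub>R axis j (1::real)) \<in> borel_measurable M"
    by measurable
  also have "(\<lambda>x. \<Sum>j\<in>UNIV. f j x *\<^sub>R axis j (1::real)) = (\<lambda>x. \<chi> j. f j x)"
    by (simp add: fun_eq_iff vec_eq_iff axis_def if_distrib[of "\<lambda>a. _ * a"] cong: if_cong)
  finally show ?thesis .
qed

lemma borel_measurable_Max_UNIV [measurable (raw)]: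
  fixes f :: "'n::finite \<Rightarrow> 'a \<Rightarrow> real"
  assumes "\<And>j. f j \<in> borel_measurable M"
  shows "(\<lambda>x. MAX j. f j x) \<in> borel_measurable M"
  using assms by (intro borel_measurable_Max) auto

lemma is_law_of_eq_law_of:
  assumes "is_law_of (law_of F) F" and "prob_space N" and "sets N = sets borel"
    and "\<And>x. F x = measure N {..x}"
  shows "N = law_of F"
  using assms law_of_eq[of N F] by (simp add: is_law_of_def)

text \<open>The formula for \<open>F\<close> in terms of a representer is restricted to the open positive orthant.
  Elsewhere the margins determine \<open>F\<close>: they give no mass to the non-positive half-line.\<close>

lemma measure_orthant_eq_0:
  fixes N :: "(real ^ 'n::finite) measure"
  assumes N: "prob_space N" and sets [measurable_cong]: "sets N = sets borel" and \<alpha>: "0 < \<alpha>"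
    and margin: "\<And>\<epsilon>. 0 < \<epsilon> \<Longrightarrow> measure N {y. y $ j \<le> \<epsilon>} = exp (- (\<epsilon> powr - \<alpha>))"
    and x: "x $ j \<le> 0"
  shows "measure N {..x} = 0"
proof -
  interpret prob_space N by fact
  have "((\<lambda>\<epsilon>. exp (- (\<epsilon> powr - \<alpha>))) \<longlongrightarrow> 0) (at_right 0)"
    using \<alpha> by real_asymp
  moreover have "\<forall>\<^sub>F \<epsilon> in at_right 0. measure N {..x} \<le> exp (- (\<epsilon> powr - \<alpha>))"
    using eventually_at_right_less[of 0]
  proof eventually_elim
    case (elim \<epsilon>)
    have "{y. y $ j \<le> \<epsilon>} \<in> sets N"
      unfolding sets by measurable
    then show ?case
      unfolding margin[OF elim, symmetric] using x elim
      by (intro finite_measure_mono) (force simp: less_eq_vec_def dest: spec[of _ j])+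
  qed
  ultimately have "measure N {..x} \<le> 0"
    by (rule tendsto_lowerbound) simp
  then show ?thesis
    by (simp add: measure_le_0_iff)
qed

lemma margin_law_of:
  assumes law: "is_law_of (law_of F) F" and marg: "unit_frechet_margins \<alpha> F" and x: "0 < x"
  shows "measure (law_of F) {y. y $ j \<le> x} = exp (- (x powr - \<alpha>))"
proof -
  have [measurable_cong]: "sets (law_of F) = sets borel"
    using law by (simp add: is_law_of_def)
  have "space (law_of F) = UNIV"
    using sets_eq_imp_space_eq[of "law_of F" borel] law by (simp add: is_law_of_def)
  then have "cdf (distr (law_of F) borel (\<lambda>y. y $ j)) x = measure (law_of F) {y. y $ j \<le> x}"
    unfolding cdf_def by (subst measure_distr) (auto simp: vimage_def)
  then show ?thesis
    using marg x by (simp add: unit_frechet_margins_def)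
qed

section \<open>The spectral construction\<close>

text \<open>The vector \<open>X\<close> of the spectral construction, for marks \<open>w\<close> that carry a representer \<open>\<zeta> w\<close>.
  Where a supremum is infinite, which has probability \<open>0\<close>, \<open>enn2real\<close> returns \<open>0\<close>.\<close>

definition spectral_vec :: "real \<Rightarrow> ('w \<Rightarrow> real ^ 'n) \<Rightarrow>
    (nat \<Rightarrow> nat \<times> (nat \<Rightarrow> real \<times> 'w)) \<Rightarrow> real ^ 'n" where
  "spectral_vec \<alpha> \<zeta> \<omega> = (\<chi> j. enn2real (point_sup (frechet_mark \<alpha> (\<lambda>w. \<zeta> w $ j)) \<omega>))"

lemma borel_measurable_spectral_vec [measurable]:
  fixes \<zeta> :: "'w \<Rightarrow> real ^ 'n::finite"
  assumes [measurable]: "\<zeta> \<in> borel_measurable P"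
  shows "spectral_vec \<alpha> \<zeta> \<in> borel_measurable (scatter (strip P))"
  unfolding spectral_vec_def by measurable

lemma nn_integral_representer_law:
  fixes g :: "real ^ 'n::finite \<Rightarrow> real"
  assumes [measurable]: "\<zeta> \<in> borel_measurable P" "g \<in> borel_measurable borel"
      "Z \<in> borel_measurable M"
    and "distr P borel \<zeta> = distr M borel Z"
  shows "(\<integral>\<^sup>+w. ennreal (g (\<zeta> w)) \<partial>P) = (\<integral>\<^sup>+w. ennreal (g (Z w)) \<partial>M)"
proof -
  have "(\<integral>\<^sup>+w. ennreal (g (\<zeta> w)) \<partial>P) = (\<integral>\<^sup>+z. ennreal (g z) \<partial>distr P borel \<zeta>)"
    by (simp add: nn_integral_distr)
  also have "\<dots> = (\<integral>\<^sup>+w. ennreal (g (Z w)) \<partial>M)"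
    by (simp add: assms nn_integral_distr)
  finally show ?thesis .
qed

lemma point_sup_frechet_mark_le_iff:
  assumes "0 \<le> c"
  shows "point_sup (frechet_mark \<alpha> h) \<omega> \<le> ennreal c
    \<longleftrightarrow> (\<forall>(s, w)\<in>points \<omega>. s powr (- 1 / \<alpha>) * h w \<le> c)"
  using assms by (fastforce simp: point_sup_def frechet_mark_def SUP_le_iff)

lemma mult_Max_le_iff:
  fixes a :: "'n::finite \<Rightarrow> real"
  assumes "0 \<le> s" "0 \<le> c"
  shows "s * (MAX j. a j) \<le> c \<longleftrightarrow> (\<forall>j. s * a j \<le> c)"
proof -
  have "s * (MAX j. a j) = (MAX j. s * a j)"
    using assms by (subst mono_Max_commute[where f = "\<lambda>x. s * x"])
      (auto intro!: monoI mult_left_mono simp: image_image)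
  then show ?thesis
    by simp
qed

text \<open>The exponent of \<open>F\<close> as a Lebesgue integral over the marks. It is finite because the maximum
  is at most the sum of the components, each of which has a finite moment of order \<open>\<alpha>\<close>. The
  components of \<open>\<zeta>\<close> may be negative on a null set, hence the positive parts.\<close>

lemma nn_integral_representer_Max:
  fixes \<zeta> :: "'w \<Rightarrow> real ^ 'n::finite"
  assumes \<zeta> [measurable]: "\<zeta> \<in> borel_measurable P" and \<alpha>: "0 < \<alpha>"
    and rep: "de_haan_representer \<alpha> F M Z" "distr P borel \<zeta> = distr M borel Z"
    and x: "\<And>j. 0 < x $ j"
  shows "\<exists>m\<ge>0. (\<integral>\<^sup>+w. ennreal (max 0 (MAX j. \<zeta> w $ j / x $ j) powr \<alpha>) \<partial>P) = ennreal m
      \<and> F x = exp (- m)"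
proof -
  have [measurable]: "Z \<in> borel_measurable M"
    and Z: "\<And>\<omega> j. \<omega> \<in> space M \<Longrightarrow> 0 \<le> Z \<omega> $ j"
    and unit: "\<And>j. (\<integral>\<omega>. (Z \<omega> $ j) powr \<alpha> \<partial>M) = 1"
    and F: "F x = exp (- (\<integral>\<omega>. (MAX j. (Z \<omega> $ j) powr \<alpha> / (x $ j) powr \<alpha>) \<partial>M))"
    using rep x by (auto simp: de_haan_representer_def)
  let ?V = "\<lambda>\<omega>. MAX j. (Z \<omega> $ j) powr \<alpha> / (x $ j) powr \<alpha>"
  have nonneg: "0 \<le> ?V \<omega>" for \<omega>
    by (subst Max_ge_iff) auto
  \<comment> \<open>The integral of a non-integrable function is \<open>0\<close> by convention, not \<open>1\<close>.\<close>
  have "integrable M (\<lambda>\<omega>. (Z \<omega> $ j) powr \<alpha>)" for j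
    using unit[of j] not_integrable_integral_eq by fastforce
  then have "integrable M (\<lambda>\<omega>. \<Sum>j\<in>UNIV. (Z \<omega> $ j) powr \<alpha> / (x $ j) powr \<alpha>)"
    by auto
  then have "integrable M ?V"
  proof (rule Bochner_Integration.integrable_bound)
    show "AE \<omega> in M. norm (?V \<omega>) \<le> norm (\<Sum>j\<in>UNIV. (Z \<omega> $ j) powr \<alpha> / (x $ j) powr \<alpha>)"
      using nonneg by (auto simp: sum_nonneg intro!: AE_I2 member_le_sum)
  qed measurable
  then have int: "(\<integral>\<^sup>+\<omega>. ennreal (?V \<omega>) \<partial>M) = ennreal (\<integral>\<omega>. ?V \<omega> \<partial>M)"
    using nonneg by (intro nn_integral_eq_integral) auto
  have "(\<integral>\<^sup>+w. ennreal (max 0 (MAX j. \<zeta> w $ j / x $ j) powr \<alpha>) \<partial>P)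
      = (\<integral>\<^sup>+\<omega>. ennreal (max 0 (MAX j. Z \<omega> $ j / x $ j) powr \<alpha>) \<partial>M)"
    using rep(2)
    by (intro nn_integral_representer_law[where g = "\<lambda>z. max 0 (MAX j. z $ j / x $ j) powr \<alpha>"]) auto
  also have "\<dots> = (\<integral>\<^sup>+\<omega>. ennreal (?V \<omega>) \<partial>M)"
  proof (rule nn_integral_cong)
    fix \<omega> assume \<omega>: "\<omega> \<in> space M"
    have "mono (\<lambda>a. max 0 a powr \<alpha>)"
      using \<alpha> by (intro monoI powr_mono2) auto
    then have "max 0 (MAX j. Z \<omega> $ j / x $ j) powr \<alpha> = (MAX j. max 0 (Z \<omega> $ j / x $ j) powr \<alpha>)"
      by (subst mono_Max_commute[where f = "\<lambda>a. max 0 a powr \<alpha>"]) (auto simp: image_image)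
    also have "\<dots> = ?V \<omega>"
      using Z[OF \<omega>] x by (simp add: powr_divide less_imp_le max_absorb2)
    finally show "ennreal (max 0 (MAX j. Z \<omega> $ j / x $ j) powr \<alpha>) = ennreal (?V \<omega>)"
      by simp
  qed
  finally show ?thesis
    using int F nonneg by (intro exI[of _ "\<integral>\<omega>. ?V \<omega> \<partial>M"]) (auto intro: integral_nonneg)
qed

lemma nn_integral_representer_margin:
  fixes \<zeta> :: "'w \<Rightarrow> real ^ 'n::finite"
  assumes \<zeta> [measurable]: "\<zeta> \<in> borel_measurable P"
    and rep: "de_haan_representer \<alpha> F M Z" "distr P borel \<zeta> = distr M borel Z"
  shows "(\<integral>\<^sup>+w. ennreal (max 0 (\<zeta> w $ j) powr \<alpha>) \<partial>P) = ennreal 1"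
proof -
  have [measurable]: "Z \<in> borel_measurable M"
    and Z: "\<And>\<omega> j. \<omega> \<in> space M \<Longrightarrow> 0 \<le> Z \<omega> $ j"
    and unit: "(\<integral>\<omega>. (Z \<omega> $ j) powr \<alpha> \<partial>M) = 1"
    using rep by (auto simp: de_haan_representer_def)
  have "(\<integral>\<^sup>+w. ennreal (max 0 (\<zeta> w $ j) powr \<alpha>) \<partial>P) = (\<integral>\<^sup>+\<omega>. ennreal (max 0 (Z \<omega> $ j) powr \<alpha>) \<partial>M)"
    using rep(2) by (intro nn_integral_representer_law[where g = "\<lambda>z. max 0 (z $ j) powr \<alpha>"]) auto
  also have "\<dots> = (\<integral>\<^sup>+\<omega>. ennreal ((Z \<omega> $ j) powr \<alpha>) \<partial>M)"
    using Z by (intro nn_integral_cong) (simp add: max_absorb2)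
  also have "\<dots> = ennreal 1"
    using unit not_integrable_integral_eq[of M "\<lambda>\<omega>. (Z \<omega> $ j) powr \<alpha>"]
    by (subst nn_integral_eq_integral) auto
  finally show ?thesis .
qed

lemma AE_point_sup_finite:
  assumes P: "prob_space P" and [measurable]: "h \<in> borel_measurable P" and \<alpha>: "0 < \<alpha>"
    and m: "(\<integral>\<^sup>+w. ennreal (max 0 (h w) powr \<alpha>) \<partial>P) = ennreal m" "0 \<le> m"
  shows "AE \<omega> in scatter (strip P). point_sup (frechet_mark \<alpha> h) \<omega> < \<top>"
proof -
  interpret prob_space "scatter (strip P)"
    by (intro prob_space_scatter prob_space_strip P)
  show ?thesis
    by (rule AE_finite_frechet[OF _ \<alpha>, of _ m]) (auto intro!: measure_point_sup_frechet_le P \<alpha> m)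
qed

text \<open>The spectral vector of a representer of \<open>F\<close> has distribution function \<open>F\<close>.\<close>

lemma distr_spectral_vec:
  fixes \<zeta> :: "'w \<Rightarrow> real ^ 'n::finite"
  assumes F: "distribution_fun F" "unit_frechet_margins \<alpha> F"
    and P: "prob_space P" and \<zeta> [measurable]: "\<zeta> \<in> borel_measurable P" and \<alpha>: "0 < \<alpha>"
    and rep: "de_haan_representer \<alpha> F M Z" "distr P borel \<zeta> = distr M borel Z"
  shows "distr (scatter (strip P)) borel (spectral_vec \<alpha> \<zeta>) = law_of F"
proof (rule is_law_of_eq_law_of)
  show law: "is_law_of (law_of F) F"
    using F(1) law_of_eq by (force simp: distribution_fun_def)
  interpret prob_space "scatter (strip P)"
    by (intro prob_space_scatter prob_space_strip P)
  let ?N = "distr (scatter (strip P)) borel (spectral_vec \<alpha> \<zeta>)"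
  show N: "prob_space ?N"
    by (rule prob_space_distr) measurable
  show "sets ?N = sets borel"
    by simp
  let ?T = "\<lambda>j. point_sup (frechet_mark \<alpha> (\<lambda>w. \<zeta> w $ j))"
  note margin = nn_integral_representer_margin[OF \<zeta> rep]
  have fin: "AE \<omega> in scatter (strip P). \<forall>j. ?T j \<omega> < \<top>"
    by (subst AE_all_countable) (auto intro!: AE_point_sup_finite[OF P _ \<alpha> margin])
  have comp: "spectral_vec \<alpha> \<zeta> \<omega> $ j \<le> a \<longleftrightarrow> ?T j \<omega> \<le> ennreal a"
    if "?T j \<omega> < \<top>" "0 < a" for j \<omega> a
    using that by (cases "?T j \<omega>") (auto simp: spectral_vec_def)
  have pos: "F x = measure ?N {..x}" if x: "\<And>j. 0 < x $ j" for x
  proof -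
    let ?h = "\<lambda>w. MAX j. \<zeta> w $ j / x $ j"
    obtain m where m: "0 \<le> m" "(\<integral>\<^sup>+w. ennreal (max 0 (?h w) powr \<alpha>) \<partial>P) = ennreal m"
        "F x = exp (- m)"
      using nn_integral_representer_Max[OF \<zeta> \<alpha> rep x] by blast
    have iff: "(\<forall>j. ?T j \<omega> \<le> ennreal (x $ j)) \<longleftrightarrow> point_sup (frechet_mark \<alpha> ?h) \<omega> \<le> ennreal 1" for \<omega>
    proof -
      have "s * \<zeta> w $ j \<le> x $ j \<longleftrightarrow> s * (\<zeta> w $ j / x $ j) \<le> 1" for s w j
        using x[of j] by (simp add: field_simps)
      then show ?thesis
        using x by (subst (1 2) point_sup_frechet_mark_le_iff)
          (auto simp: less_imp_le mult_Max_le_iff)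
    qed
    have "measure ?N {..x} = measure (scatter (strip P))
        {\<omega> \<in> space (scatter (strip P)). spectral_vec \<alpha> \<zeta> \<omega> \<le> x}"
      by (subst measure_distr) (auto intro!: arg_cong[where f = "measure _"])
    also have "\<dots> = measure (scatter (strip P))
        {\<omega> \<in> space (scatter (strip P)). point_sup (frechet_mark \<alpha> ?h) \<omega> \<le> ennreal 1}"
    proof (rule finite_measure_eq_AE)
      show "AE \<omega> in scatter (strip P).
          (\<omega> \<in> {\<omega> \<in> space (scatter (strip P)). spectral_vec \<alpha> \<zeta> \<omega> \<le> x}) =
          (\<omega> \<in> {\<omega> \<in> space (scatter (strip P)). point_sup (frechet_mark \<alpha> ?h) \<omega> \<le> ennreal 1})"
        using fin by eventually_elim (use comp x iff in \<open>auto simp: less_eq_vec_def\<close>)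
      have "spectral_vec \<alpha> \<zeta> -` {..x} \<inter> space (scatter (strip P)) \<in> events"
        by (rule measurable_sets) measurable
      then show "{\<omega> \<in> space (scatter (strip P)). spectral_vec \<alpha> \<zeta> \<omega> \<le> x} \<in> events"
        by (simp add: vimage_def Int_def conj_commute)
    qed measurable
    also have "\<dots> = exp (- (m / 1 powr \<alpha>))"
      by (rule measure_point_sup_frechet_le) (use P \<alpha> m in auto)
    finally show ?thesis
      using m by simp
  qed
  have "measure ?N {y. y $ j \<le> \<epsilon>} = exp (- (\<epsilon> powr - \<alpha>))" if \<epsilon>: "0 < \<epsilon>" for j \<epsilon>
  proof -
    have "measure ?N {y. y $ j \<le> \<epsilon>} = measure (scatter (strip P))
        {\<omega> \<in> space (scatter (strip P)). spectral_vec \<alpha> \<zeta> \<omega> $ j \<le> \<epsilon>}"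
      by (subst measure_distr) (auto intro!: arg_cong[where f = "measure _"])
    also have "\<dots> = measure (scatter (strip P))
        {\<omega> \<in> space (scatter (strip P)). ?T j \<omega> \<le> ennreal \<epsilon>}"
    proof (rule finite_measure_eq_AE)
      show "AE \<omega> in scatter (strip P).
          (\<omega> \<in> {\<omega> \<in> space (scatter (strip P)). spectral_vec \<alpha> \<zeta> \<omega> $ j \<le> \<epsilon>}) =
          (\<omega> \<in> {\<omega> \<in> space (scatter (strip P)). ?T j \<omega> \<le> ennreal \<epsilon>})"
        using fin by eventually_elim (use comp \<epsilon> in auto)
    qed measurable
    also have "\<dots> = exp (- (1 / \<epsilon> powr \<alpha>))"
      by (rule measure_point_sup_frechet_le) (use P \<alpha> \<epsilon> margin in auto)
    finally show ?thesis
      by (simp add: powr_minus divide_inverse)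
  qed
  then have zeroN: "measure ?N {..x} = 0" if "x $ j \<le> 0" for x j
    using that by (intro measure_orthant_eq_0[OF N _ \<alpha>]) auto
  have zeroF: "F x = 0" if "x $ j \<le> 0" for x j
    using measure_orthant_eq_0[of "law_of F" \<alpha> j x] law margin_law_of[OF law F(2)] \<alpha> that
    by (simp add: is_law_of_def)
  show "F x = measure ?N {..x}" for x
    by (cases "\<forall>j. 0 < x $ j") (use pos zeroN zeroF in \<open>force simp: not_less\<close>)+
qed

section \<open>Distances between spectral vectors\<close>

lemma nn_integral_point_sup_powr:
  assumes P: "prob_space P" and h [measurable]: "h \<in> borel_measurable P"
    and p: "0 < p" "p < \<alpha>" and m: "0 \<le> m"
    and int: "(\<integral>\<^sup>+w. ennreal (max 0 (h w) powr \<alpha>) \<partial>P) = ennreal m"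
  shows "(\<integral>\<^sup>+\<omega>. ennreal (enn2real (point_sup (frechet_mark \<alpha> h) \<omega>) powr p) \<partial>scatter (strip P))
         = ennreal (Gamma (1 - p / \<alpha>) * m powr (p / \<alpha>))"
proof -
  interpret prob_space "scatter (strip P)"
    by (intro prob_space_scatter prob_space_strip P)
  show ?thesis
    using p m
    by (intro nn_integral_frechet_powr measure_point_sup_frechet_le[OF P h _ _ m int]) auto
qed

lemma point_sup_frechet_mark_triangle:
  assumes "\<And>w. f w \<le> g w + h w" and "\<And>w. 0 \<le> h w"
  shows "point_sup (frechet_mark \<alpha> f) \<omega>
    \<le> point_sup (frechet_mark \<alpha> g) \<omega> + point_sup (frechet_mark \<alpha> h) \<omega>"
proof -
  have "frechet_mark \<alpha> f x \<le> frechet_mark \<alpha> g x + frechet_mark \<alpha> h x" for x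
  proof (cases x)
    case (Pair s w)
    let ?s = "s powr (- 1 / \<alpha>)"
    have le: "?s * f w \<le> ?s * g w + ?s * h w"
      using assms(1)[of w] by (simp flip: distrib_left add: mult_left_mono)
    show ?thesis
    proof (cases "0 \<le> ?s * g w")
      case True
      then show ?thesis
        using le assms(2)[of w] Pair by (simp add: frechet_mark_def ennreal_leI flip: ennreal_plus)
    next
      case False
      then have "ennreal (?s * f w) \<le> ennreal (?s * h w)"
        using le by (intro ennreal_leI) simp
      then show ?thesis
        using Pair by (auto simp: frechet_mark_def intro: add_increasing)
    qed
  qed
  then show ?thesis
    unfolding point_sup_def by (intro SUP_least order_trans[OF _ add_mono[OF SUP_upper SUP_upper]])
qed

lemma enn2real_dist_le:
  assumes "a \<le> b + t" "b \<le> a + t" "a < \<top>" "b < \<top>" "t < \<top>"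
  shows "\<bar>enn2real a - enn2real b\<bar> \<le> enn2real t"
  using assms by (cases a; cases b; cases t) (auto simp flip: ennreal_plus)

lemma spectral_vec_dist_le:
  fixes \<zeta> \<zeta>' :: "'w \<Rightarrow> real ^ 'n::finite"
  assumes le: "\<And>w. \<bar>\<zeta> w $ j - \<zeta>' w $ j\<bar> \<le> h w"
    and fin: "point_sup (frechet_mark \<alpha> (\<lambda>w. \<zeta> w $ j)) \<omega> < \<top>"
      "point_sup (frechet_mark \<alpha> (\<lambda>w. \<zeta>' w $ j)) \<omega> < \<top>"
      "point_sup (frechet_mark \<alpha> h) \<omega> < \<top>"
  shows "\<bar>spectral_vec \<alpha> \<zeta> \<omega> $ j - spectral_vec \<alpha> \<zeta>' \<omega> $ j\<bar>
    \<le> enn2real (point_sup (frechet_mark \<alpha> h) \<omega>)"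
proof -
  have h: "\<zeta> w $ j \<le> \<zeta>' w $ j + h w" "\<zeta>' w $ j \<le> \<zeta> w $ j + h w" "0 \<le> h w" for w
    using le[of w] by linarith+
  show ?thesis
    unfolding spectral_vec_def vec_lambda_beta
    by (intro enn2real_dist_le point_sup_frechet_mark_triangle h fin)
qed

section \<open>Upper bounds for Wasserstein distances\<close>

lemma distr_pair_in_couplings:
  assumes [measurable]: "X \<in> borel_measurable M" "Y \<in> borel_measurable M"
  shows "distr M (borel \<Otimes>\<^sub>M borel) (\<lambda>\<omega>. (X \<omega>, Y \<omega>)) \<in> couplings (distr M borel X) (distr M borel Y)"
proof -
  let ?\<kappa> = "distr M (borel \<Otimes>\<^sub>M borel) (\<lambda>\<omega>. (X \<omega>, Y \<omega>))"
  have "distr ?\<kappa> (distr M borel X) fst = distr ?\<kappa> borel fst"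
    "distr ?\<kappa> (distr M borel Y) snd = distr ?\<kappa> borel snd"
    by (intro distr_cong; simp)+
  then show ?thesis
    by (simp add: couplings_def distr_distr comp_def cong: sets_pair_measure_cong)
qed

lemma ennreal_powr_mono:
  assumes "x \<le> y" "0 \<le> r"
  shows "ennreal_powr x r \<le> ennreal_powr y r"
  using assms
  by (cases x; cases y) (auto simp: ennreal_powr_def top_unique intro!: ennreal_leI powr_mono2)

lemma ennreal_powr_ennreal [simp]: "0 \<le> x \<Longrightarrow> ennreal_powr (ennreal x) r = ennreal (x powr r)"
  by (simp add: ennreal_powr_def)

lemma ennreal_powr_top [simp]: "ennreal_powr \<top> r = \<top>"
  by (simp add: ennreal_powr_def)

lemma wasserstein_distr_le:
  fixes X Y :: "'a \<Rightarrow> real ^ 'n::finite"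
  assumes [measurable]: "X \<in> borel_measurable M" "Y \<in> borel_measurable M"
      "N \<in> borel_measurable borel"
  shows "wasserstein q N (distr M borel X) (distr M borel Y)
    \<le> ennreal_powr (\<integral>\<^sup>+\<omega>. ennreal (N (X \<omega> - Y \<omega>) powr q) \<partial>M) (1 / q)"
proof -
  have "(\<integral>\<^sup>+(x, y). ennreal (N (x - y) powr q) \<partial>distr M (borel \<Otimes>\<^sub>M borel) (\<lambda>\<omega>. (X \<omega>, Y \<omega>)))
      = (\<integral>\<^sup>+\<omega>. ennreal (N (X \<omega> - Y \<omega>) powr q) \<partial>M)"
    by (subst nn_integral_distr) auto
  then show ?thesis
    unfolding wasserstein_def
    by (intro INF_lower2[OF distr_pair_in_couplings]) auto
qed

lemma infnorm_le_iff_cart: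
  fixes x :: "real ^ 'n::finite"
  shows "infnorm x \<le> c \<longleftrightarrow> (\<forall>j. \<bar>x $ j\<bar> \<le> c)"
proof
  show "infnorm x \<le> c \<Longrightarrow> \<forall>j. \<bar>x $ j\<bar> \<le> c"
    using order_trans[OF component_le_infnorm_cart] by blast
  show "\<forall>j. \<bar>x $ j\<bar> \<le> c \<Longrightarrow> infnorm x \<le> c"
    unfolding infnorm_cart by (rule cSup_least) auto
qed

lemma borel_measurable_infnorm [measurable]:
  "(infnorm :: real ^ 'n::finite \<Rightarrow> real) \<in> borel_measurable borel"
  by (intro borel_measurable_continuous_onI continuous_intros)

lemma borel_measurable_l1norm [measurable]:
  "(l1norm :: real ^ 'n::finite \<Rightarrow> real) \<in> borel_measurable borel"
  unfolding l1norm_def by measurable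

lemma ennreal_le_mult_INF:
  fixes a c :: ennreal
  assumes "0 < c" "c < \<top>" and "\<And>i. i \<in> A \<Longrightarrow> a \<le> c * f i"
  shows "a \<le> c * (INF i\<in>A. f i)"
proof -
  have "a = c * (a / c)"
    using assms by (simp add: ennreal_times_divide mult.commute[of c] mult_divide_eq_ennreal)
  also have "\<dots> \<le> c * (INF i\<in>A. f i)"
    using assms by (intro mult_left_mono INF_greatest divide_le_posI_ennreal) auto
  finally show ?thesis .
qed

lemma le_mult_wasserstein:
  fixes a c :: ennreal
  assumes "0 < c" "c < \<top>"
    and "\<And>\<pi>. \<pi> \<in> couplings \<mu> \<nu> \<Longrightarrow>
      a \<le> c * ennreal_powr (\<integral>\<^sup>+(x, y). ennreal (N (x - y) powr q) \<partial>\<pi>) (1 / q)"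
  shows "a \<le> c * wasserstein q N \<mu> \<nu>"
  unfolding wasserstein_def using assms by (rule ennreal_le_mult_INF)

section \<open>Transfer of couplings\<close>

text \<open>Representers \<open>\<zeta>\<close> of \<open>F\<^sub>1\<close> and \<open>\<zeta>'\<close> of \<open>F\<^sub>2\<close> on one probability space \<open>P\<close>: a coupling of
  representers. Both spectral vectors below use the same Poisson process, whose marks have law
  \<open>P\<close>.\<close>

locale coupled_representers =
  fixes F\<^sub>1 F\<^sub>2 :: "real ^ 'n::finite \<Rightarrow> real" and \<alpha> p :: real
    and P :: "'w measure" and \<zeta> \<zeta>' :: "'w \<Rightarrow> real ^ 'n"
  assumes F1: "distribution_fun F\<^sub>1" "unit_frechet_margins \<alpha> F\<^sub>1"
    and F2: "distribution_fun F\<^sub>2" "unit_frechet_margins \<alpha> F\<^sub>2"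
    and p: "1 \<le> p" "p < \<alpha>"
    and P: "prob_space P"
    and meas [measurable]: "\<zeta> \<in> borel_measurable P" "\<zeta>' \<in> borel_measurable P"
    and rep1: "distr P borel \<zeta> \<in> representer_laws \<alpha> F\<^sub>1"
    and rep2: "distr P borel \<zeta>' \<in> representer_laws \<alpha> F\<^sub>2"
begin

lemma alpha_pos: "0 < \<alpha>"
  using p by simp

lemma Gamma_pos: "0 < Gamma (1 - p / \<alpha>)"
  using p by (intro Gamma_real_pos) simp

lemma laws:
  "distr (scatter (strip P)) borel (spectral_vec \<alpha> \<zeta>) = law_of F\<^sub>1"
  "distr (scatter (strip P)) borel (spectral_vec \<alpha> \<zeta>') = law_of F\<^sub>2"
  using rep1 rep2 distr_spectral_vec[OF F1 P meas(1) alpha_pos]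
    distr_spectral_vec[OF F2 P meas(2) alpha_pos]
  by (auto simp: representer_laws_def)

lemma AE_margins_finite:
  "AE \<omega> in scatter (strip P). \<forall>j. point_sup (frechet_mark \<alpha> (\<lambda>w. \<zeta> w $ j)) \<omega> < \<top>
     \<and> point_sup (frechet_mark \<alpha> (\<lambda>w. \<zeta>' w $ j)) \<omega> < \<top>"
proof -
  have "(\<integral>\<^sup>+w. ennreal (max 0 (\<zeta> w $ j) powr \<alpha>) \<partial>P) = ennreal 1"
    "(\<integral>\<^sup>+w. ennreal (max 0 (\<zeta>' w $ j) powr \<alpha>) \<partial>P) = ennreal 1" for j
    using rep1 rep2 nn_integral_representer_margin[OF meas(1)]
      nn_integral_representer_margin[OF meas(2)]
    unfolding representer_laws_def by blast+
  then have "AE \<omega> in scatter (strip P). point_sup (frechet_mark \<alpha> (\<lambda>w. \<zeta> w $ j)) \<omega> < \<top>"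
    "AE \<omega> in scatter (strip P). point_sup (frechet_mark \<alpha> (\<lambda>w. \<zeta>' w $ j)) \<omega> < \<top>" for j
    by (auto intro!: AE_point_sup_finite[OF P _ alpha_pos])
  then show ?thesis
    by (simp add: AE_all_countable)
qed

lemma AE_dist_le:
  assumes [measurable]: "\<And>j. h j \<in> borel_measurable P"
    and le: "\<And>j w. \<bar>\<zeta> w $ j - \<zeta>' w $ j\<bar> \<le> h j w"
    and m: "\<And>j. (\<integral>\<^sup>+w. ennreal (h j w powr \<alpha>) \<partial>P) = ennreal (m j)" "\<And>j. 0 \<le> m j"
  shows "AE \<omega> in scatter (strip P). \<forall>j. \<bar>spectral_vec \<alpha> \<zeta> \<omega> $ j - spectral_vec \<alpha> \<zeta>' \<omega> $ j\<bar>
    \<le> enn2real (point_sup (frechet_mark \<alpha> (h j)) \<omega>)"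
proof -
  have "max 0 (h j w) = h j w" for j w
    using order_trans[OF abs_ge_zero le] by (simp add: max_absorb2)
  then have "AE \<omega> in scatter (strip P). \<forall>j. point_sup (frechet_mark \<alpha> (h j)) \<omega> < \<top>"
    using m by (subst AE_all_countable) (auto intro!: AE_point_sup_finite[OF P _ alpha_pos])
  with AE_margins_finite show ?thesis
    by eventually_elim (auto intro!: spectral_vec_dist_le le)
qed

lemma wasserstein_infnorm_le:
  "wasserstein p infnorm (law_of F\<^sub>1) (law_of F\<^sub>2)
     \<le> ennreal (Gamma (1 - p / \<alpha>) powr (1 / p))
        * ennreal_powr (\<integral>\<^sup>+w. ennreal (infnorm (\<zeta> w - \<zeta>' w) powr \<alpha>) \<partial>P) (1 / \<alpha>)"
proof (cases "\<integral>\<^sup>+w. ennreal (infnorm (\<zeta> w - \<zeta>' w) powr \<alpha>) \<partial>P")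
  case top
  then show ?thesis
    using Gamma_pos by (simp add: ennreal_mult_top)
next
  case (real m)
  let ?h = "\<lambda>w. infnorm (\<zeta> w - \<zeta>' w)"
  let ?T = "point_sup (frechet_mark \<alpha> ?h)"
  have "AE \<omega> in scatter (strip P). \<forall>j. \<bar>spectral_vec \<alpha> \<zeta> \<omega> $ j - spectral_vec \<alpha> \<zeta>' \<omega> $ j\<bar>
      \<le> enn2real (?T \<omega>)"
    using real component_le_infnorm_cart[of "\<zeta> _ - \<zeta>' _"]
    by (intro AE_dist_le[where h = "\<lambda>_. ?h" and m = "\<lambda>_. m"]) auto
  then have "(\<integral>\<^sup>+\<omega>. ennreal (infnorm (spectral_vec \<alpha> \<zeta> \<omega> - spectral_vec \<alpha> \<zeta>' \<omega>) powr p)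
        \<partial>scatter (strip P)) \<le> (\<integral>\<^sup>+\<omega>. ennreal (enn2real (?T \<omega>) powr p) \<partial>scatter (strip P))"
    using p by (intro nn_integral_mono_AE)
      (auto elim!: eventually_mono intro!: ennreal_leI powr_mono2
        simp: infnorm_pos_le infnorm_le_iff_cart)
  also have "\<dots> = ennreal (Gamma (1 - p / \<alpha>) * m powr (p / \<alpha>))"
    using p real by (intro nn_integral_point_sup_powr[OF P]) (auto simp: infnorm_pos_le max_absorb2)
  finally have "wasserstein p infnorm (law_of F\<^sub>1) (law_of F\<^sub>2)
      \<le> ennreal_powr (ennreal (Gamma (1 - p / \<alpha>) * m powr (p / \<alpha>))) (1 / p)"
    using p unfolding laws[symmetric]
    by (intro order_trans[OF wasserstein_distr_le] ennreal_powr_mono) auto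
  also have "\<dots> = ennreal (Gamma (1 - p / \<alpha>) powr (1 / p)) * ennreal (m powr (1 / \<alpha>))"
    using p Gamma_pos by (simp add: powr_mult powr_powr flip: ennreal_mult)
  finally show ?thesis
    using real by simp
qed

lemma wasserstein_l1norm_le:
  "wasserstein p l1norm (law_of F\<^sub>1) (law_of F\<^sub>2)
     \<le> ennreal (Gamma (1 - p / \<alpha>) powr (1 / p))
        * (\<Sum>j\<in>UNIV. ennreal_powr (\<integral>\<^sup>+w. ennreal (\<bar>\<zeta> w $ j - \<zeta>' w $ j\<bar> powr \<alpha>) \<partial>P) (1 / \<alpha>))"
proof (cases "\<exists>j. (\<integral>\<^sup>+w. ennreal (\<bar>\<zeta> w $ j - \<zeta>' w $ j\<bar> powr \<alpha>) \<partial>P) = \<top>")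
  case True
  then obtain i where "(\<integral>\<^sup>+w. ennreal (\<bar>\<zeta> w $ i - \<zeta>' w $ i\<bar> powr \<alpha>) \<partial>P) = \<top>" ..
  then have top: "(\<Sum>j\<in>UNIV. ennreal_powr
      (\<integral>\<^sup>+w. ennreal (\<bar>\<zeta> w $ j - \<zeta>' w $ j\<bar> powr \<alpha>) \<partial>P) (1 / \<alpha>)) = \<top>"
    by (subst ennreal_sum_eq_top) (auto intro!: exI[of _ i])
  show ?thesis
    unfolding top using Gamma_pos by (simp add: ennreal_mult_top)
next
  case False
  let ?G = "Gamma (1 - p / \<alpha>)"
  let ?h = "\<lambda>j w. \<bar>\<zeta> w $ j - \<zeta>' w $ j\<bar>"
  let ?T = "\<lambda>j. point_sup (frechet_mark \<alpha> (?h j))"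
  define m where "m j = enn2real (\<integral>\<^sup>+w. ennreal (?h j w powr \<alpha>) \<partial>P)" for j
  have m: "(\<integral>\<^sup>+w. ennreal (?h j w powr \<alpha>) \<partial>P) = ennreal (m j)" "0 \<le> m j" for j
    using False by (auto simp: m_def less_top)
  have moment: "(\<integral>\<^sup>+\<omega>. ennreal (enn2real (?T j \<omega>) powr p) \<partial>scatter (strip P))
      = ennreal (?G * m j powr (p / \<alpha>))" for j
    using p m by (intro nn_integral_point_sup_powr[OF P]) (auto simp: max_absorb2)
  have "AE \<omega> in scatter (strip P). \<forall>j. \<bar>spectral_vec \<alpha> \<zeta> \<omega> $ j - spectral_vec \<alpha> \<zeta>' \<omega> $ j\<bar>
      \<le> enn2real (?T j \<omega>)"
    using m by (intro AE_dist_le) auto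
  then have l1: "(\<integral>\<^sup>+\<omega>. ennreal (l1norm (spectral_vec \<alpha> \<zeta> \<omega> - spectral_vec \<alpha> \<zeta>' \<omega>) powr p)
        \<partial>scatter (strip P)) \<le> (\<integral>\<^sup>+\<omega>. ennreal ((\<Sum>j\<in>UNIV. enn2real (?T j \<omega>)) powr p) \<partial>scatter (strip P))"
    using p by (intro nn_integral_mono_AE)
      (auto elim!: eventually_mono intro!: ennreal_leI powr_mono2 sum_mono sum_nonneg
        simp: l1norm_def)
  have "wasserstein p l1norm (law_of F\<^sub>1) (law_of F\<^sub>2)
      \<le> ennreal (\<Sum>j\<in>UNIV. ?G powr (1 / p) * m j powr (1 / \<alpha>))"
  proof (rule ennreal_le_epsilon)
    fix e :: real assume e: "0 < e"
    \<comment> \<open>Some of the \<open>m j\<close> may be \<open>0\<close>; the summand with \<open>e\<close> makes the bounds \<open>c j\<close> positive.\<close>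
    define c where "c j = ?G powr (1 / p) * m j powr (1 / \<alpha>) + e / CARD('n)" for j
    have c: "0 < c j" for j
      using e by (auto simp: c_def intro!: add_nonneg_pos)
    have "?G * m j powr (p / \<alpha>) \<le> c j powr p" for j
    proof -
      have "?G * m j powr (p / \<alpha>) = (?G powr (1 / p) * m j powr (1 / \<alpha>)) powr p"
        using p Gamma_pos by (simp add: powr_mult powr_powr)
      also have "\<dots> \<le> c j powr p"
        using p e by (intro powr_mono2) (auto simp: c_def)
      finally show ?thesis .
    qed
    then have "(\<integral>\<^sup>+\<omega>. ennreal ((\<Sum>j\<in>UNIV. enn2real (?T j \<omega>)) powr p) \<partial>scatter (strip P))
        \<le> ennreal ((\<Sum>j\<in>UNIV. c j) powr p)"
      using p c by (intro minkowski_sum) (auto simp: moment intro!: ennreal_leI)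
    from order_trans[OF l1 this]
    have "wasserstein p l1norm (law_of F\<^sub>1) (law_of F\<^sub>2)
        \<le> ennreal_powr (ennreal ((\<Sum>j\<in>UNIV. c j) powr p)) (1 / p)"
      using p unfolding laws[symmetric]
      by (intro order_trans[OF wasserstein_distr_le] ennreal_powr_mono) auto
    also have "\<dots> = ennreal (\<Sum>j\<in>UNIV. c j)"
      using p c by (simp add: powr_powr sum_nonneg less_imp_le)
    also have "(\<Sum>j\<in>UNIV. c j) = (\<Sum>j\<in>UNIV. ?G powr (1 / p) * m j powr (1 / \<alpha>)) + e"
      by (simp add: c_def sum.distrib)
    finally show "wasserstein p l1norm (law_of F\<^sub>1) (law_of F\<^sub>2)
        \<le> ennreal (\<Sum>j\<in>UNIV. ?G powr (1 / p) * m j powr (1 / \<alpha>)) + ennreal e"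
      using e by (simp add: ennreal_plus sum_nonneg)
  qed
  also have "\<dots> = ennreal (?G powr (1 / p)) * (\<Sum>j\<in>UNIV. ennreal (m j powr (1 / \<alpha>)))"
    by (simp add: sum_nonneg flip: sum_distrib_left ennreal_mult)
  finally show ?thesis
    using m by simp
qed

end

lemma coupled_representers_of_coupling:
  fixes F\<^sub>1 F\<^sub>2 :: "real ^ 'n::finite \<Rightarrow> real"
  assumes "max_stable F\<^sub>1" and "unit_frechet_margins \<alpha> F\<^sub>1"
    and "max_stable F\<^sub>2" and "unit_frechet_margins \<alpha> F\<^sub>2"
    and "1 \<le> p" and "p < \<alpha>"
    and \<mu>: "\<mu> \<in> representer_laws \<alpha> F\<^sub>1" and \<nu>: "\<nu> \<in> representer_laws \<alpha> F\<^sub>2"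
    and \<pi>: "\<pi> \<in> couplings \<mu> \<nu>"
  shows "coupled_representers F\<^sub>1 F\<^sub>2 \<alpha> p \<pi> fst snd"
proof -
  have sets: "sets \<mu> = sets borel" "sets \<nu> = sets borel"
    using \<mu> \<nu> by (auto simp: representer_laws_def)
  have [measurable_cong]: "sets \<pi> = sets (borel \<Otimes>\<^sub>M borel)"
    using \<pi> by (simp add: couplings_def sets cong: sets_pair_measure_cong)
  have "distr \<pi> borel fst = \<mu>" "distr \<pi> borel snd = \<nu>"
    using \<pi> distr_cong[of \<pi> \<pi> borel \<mu> fst fst] distr_cong[of \<pi> \<pi> borel \<nu> snd snd] sets
    by (simp_all add: couplings_def)
  moreover have "prob_space \<mu>"
    using \<mu> by (auto simp: representer_laws_def de_haan_representer_def
        intro: prob_space.prob_space_distr)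
  moreover have "fst \<in> borel_measurable \<pi>" "snd \<in> borel_measurable \<pi>"
    by measurable
  ultimately show ?thesis
    using assms prob_space_distrD[of fst \<pi> borel]
    by (intro coupled_representers.intro) (auto simp: max_stable_def)
qed

theorem theorem3p3:
  fixes F\<^sub>1 F\<^sub>2 :: "real ^ 'n::finite \<Rightarrow> real" and \<alpha> p :: real
  assumes "max_stable F\<^sub>1" and "unit_frechet_margins \<alpha> F\<^sub>1"
    and "max_stable F\<^sub>2" and "unit_frechet_margins \<alpha> F\<^sub>2"
    and "1 \<le> p" and "p < \<alpha>"
  shows "wasserstein p infnorm (law_of F\<^sub>1) (law_of F\<^sub>2)
           \<le> ennreal (Gamma (1 - p / \<alpha>) powr (1 / p)) * rep_wasserstein \<alpha> F\<^sub>1 F\<^sub>2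
       \<and> wasserstein p l1norm (law_of F\<^sub>1) (law_of F\<^sub>2)
           \<le> ennreal (Gamma (1 - p / \<alpha>) powr (1 / p)) * rep_cost \<alpha> F\<^sub>1 F\<^sub>2"
proof -
  let ?c = "ennreal (Gamma (1 - p / \<alpha>) powr (1 / p))"
  have "0 < Gamma (1 - p / \<alpha>)"
    using assms by (intro Gamma_real_pos) simp
  then have c: "0 < ?c" "?c < \<top>"
    by auto
  have bounds: "wasserstein p infnorm (law_of F\<^sub>1) (law_of F\<^sub>2)
        \<le> ?c * ennreal_powr (\<integral>\<^sup>+(z, z'). ennreal (infnorm (z - z') powr \<alpha>) \<partial>\<pi>) (1 / \<alpha>)"
    "wasserstein p l1norm (law_of F\<^sub>1) (law_of F\<^sub>2)
        \<le> ?c * (\<Sum>j\<in>UNIV. ennreal_powr (\<integral>\<^sup>+(z, z'). ennreal (\<bar>z $ j - z' $ j\<bar> powr \<alpha>) \<partial>\<pi>) (1 / \<alpha>))"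
    if "\<mu> \<in> representer_laws \<alpha> F\<^sub>1" "\<nu> \<in> representer_laws \<alpha> F\<^sub>2" "\<pi> \<in> couplings \<mu> \<nu>" for \<mu> \<nu> \<pi>
  proof -
    interpret coupled_representers F\<^sub>1 F\<^sub>2 \<alpha> p \<pi> fst snd
      using assms that by (rule coupled_representers_of_coupling)
    show "wasserstein p infnorm (law_of F\<^sub>1) (law_of F\<^sub>2)
        \<le> ?c * ennreal_powr (\<integral>\<^sup>+(z, z'). ennreal (infnorm (z - z') powr \<alpha>) \<partial>\<pi>) (1 / \<alpha>)"
      using wasserstein_infnorm_le by (simp add: case_prod_beta')
    show "wasserstein p l1norm (law_of F\<^sub>1) (law_of F\<^sub>2)
        \<le> ?c * (\<Sum>j\<in>UNIV. ennreal_powr (\<integral>\<^sup>+(z, z'). ennreal (\<bar>z $ j - z' $ j\<bar> powr \<alpha>) \<partial>\<pi>) (1 / \<alpha>))"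
      using wasserstein_l1norm_le by (simp add: case_prod_beta')
  qed
  show ?thesis
  proof
    have "wasserstein p infnorm (law_of F\<^sub>1) (law_of F\<^sub>2) \<le> ?c * wasserstein \<alpha> infnorm \<mu> \<nu>"
      if "\<mu> \<in> representer_laws \<alpha> F\<^sub>1" "\<nu> \<in> representer_laws \<alpha> F\<^sub>2" for \<mu> \<nu>
      using that by (intro le_mult_wasserstein c bounds)
    then show "wasserstein p infnorm (law_of F\<^sub>1) (law_of F\<^sub>2) \<le> ?c * rep_wasserstein \<alpha> F\<^sub>1 F\<^sub>2"
      unfolding rep_wasserstein_def by (intro ennreal_le_mult_INF c)
    show "wasserstein p l1norm (law_of F\<^sub>1) (law_of F\<^sub>2) \<le> ?c * rep_cost \<alpha> F\<^sub>1 F\<^sub>2"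
      unfolding rep_cost_def by (intro ennreal_le_mult_INF c bounds)
  qed
qed

end
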